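(* Let $\frac n2+\frac12<\alpha<\frac n2+1$ and let $$\mathbf{W}_\alpha(t,x)=\int_{\mathbb{R}_+\times\mathbf{H}^n}\mathbf{1}_{[0,t]}(r)\,\big(G_\alpha(x,q)-G_\alpha(e,q)\big)\,dW_{\mathbf{H}^n}(r,q),\qquad t\ge0,\ x\in\mathbf{H}^n.$$ Then for any $\lambda>0$, $$\{\mathbf{W}_\alpha(t,\delta_\lambda x);\ t\ge0,x\in\mathbf{H}^n\}\stackrel{\mathcal{D}}{=}\lambda^{2\alpha-(n+1)}\{\mathbf{W}_\alpha(t,x);\ t\ge0,x\in\mathbf{H}^n\}.$$
   Context: Let $n\ge1$. The Heisenberg group $\mathbf{H}^n$ is $\mathbb{R}^n\times\mathbb{R}^n\times\mathbb{R}$ with product $(x,y,z)\star(x',y',z')=(x+x',y+y',z+z'+2\sum_{i=1}^n(x_i'y_i-x_iy_i'))$ and identity $e=(0,0,0)$; $\mu$ is Lebesgue measure on $\mathbb{R}^{2n+1}$. Let $X_i=\partial_{x_i}+2y_i\partial_z$, $Y_i=\partial_{y_i}-2x_i\partial_z$ and $\Delta=\sum_{i=1}^n(X_i^2+Y_i^2)$ (self-adjoint on $L^2(\mathbf{H}^n,\mu)$). For $0<\alpha<n+1$, $G_\alpha(q_1,q_2)=\frac{1}{\Gamma(\alpha)}\int_0^\infty t^{\alpha-1}h_t(q_1^{-1}q_2)\,dt$ is the integral kernel of $(-\Delta)^{-\alpha}$, where $h_t(q_1^{-1}q_2)$ is the kernel (w.r.t. $\mu$) of $e^{t\Delta}$.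 For $\frac{n+1}2<\alpha<\frac n2+1$, $G_\alpha(x,\cdot)-G_\alpha(e,\cdot)\in L^2(\mathbf{H}^n,\mu)$ for every $x\in\mathbf{H}^n$. $W_{\mathbf{H}^n}$ is a white noise on $\mathbb{R}_+\times\mathbf{H}^n$, i.e. a centered Gaussian family indexed by $L^2(\mathbb{R}_+\times\mathbf{H}^n;dt\otimes\mu)$ with covariance $\int_{\mathbb{R}_+\times\mathbf{H}^n}f\,g\,d\mu\,dt$. The dilation is $\delta_\lambda(x,y,z)=(\lambda x,\lambda y,\lambda^2z)$. $\stackrel{\mathcal{D}}{=}$ denotes equality in law of processes. *)

theory Defs
  imports "HOL-Probability.Probability"
begin

section \<open>The Heisenberg group\<close>

type_synonym 'n heis = "(real ^ 'n) \<times> (real ^ 'n) \<times> real"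

fun heis_mult :: "'n::finite heis \<Rightarrow> 'n heis \<Rightarrow> 'n heis" (infixl "\<star>" 70) where
  "(x, y, z) \<star> (x', y', z') = (x + x', y + y', z + z' + 2 * (\<Sum>i\<in>UNIV. x' $ i * y $ i - x $ i * y' $ i))"

definition heis_e :: "'n::finite heis" where
  "heis_e = (0, 0, 0)"

fun heis_inv :: "'n::finite heis \<Rightarrow> 'n heis" where
  "heis_inv (x, y, z) = (- x, - y, - z)"

lemma heis_group:
  fixes p q r :: "'n::finite heis"
  shows "p \<star> q \<star> r = p \<star> (q \<star> r)" "heis_e \<star> p = p" "p \<star> heis_e = p"
    "heis_inv p \<star> p = heis_e" "p \<star> heis_inv p = heis_e"
  by (cases p; cases q; cases r;
      simp add: heis_e_def algebra_simps sum.distrib sum_subtractf sum_negf)+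

fun heis_dil :: "real \<Rightarrow> 'n::finite heis \<Rightarrow> 'n heis" where
  "heis_dil l (x, y, z) = (l *\<^sub>R x, l *\<^sub>R y, l\<^sup>2 * z)"

section \<open>Square integrable functions and contraction semigroups\<close>

text \<open>Elements of \<open>L\<^sup>2(M)\<close> are represented by measurable functions; identities between them are
  therefore stated almost everywhere or through the seminorm.\<close>

definition L2 :: "'a measure \<Rightarrow> ('a \<Rightarrow> real) set" where
  "L2 M = {f \<in> borel_measurable M. integrable M (\<lambda>x. (f x)\<^sup>2)}"

definition L2_norm :: "'a measure \<Rightarrow> ('a \<Rightarrow> real) \<Rightarrow> real" where
  "L2_norm M f = sqrt (LINT x|M. (f x)\<^sup>2)"

definition contraction_semigroup ::
    "'a measure \<Rightarrow> (real \<Rightarrow> ('a \<Rightarrow> real) \<Rightarrow> 'a \<Rightarrow> real) \<Rightarrow> bool" where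
  "contraction_semigroup M P \<longleftrightarrow>
     (\<forall>t\<ge>0. \<forall>f\<in>L2 M. P t f \<in> L2 M \<and> L2_norm M (P t f) \<le> L2_norm M f) \<and>
     (\<forall>t\<ge>0. \<forall>f\<in>L2 M. \<forall>g\<in>L2 M. \<forall>a b.
        AE x in M. P t (\<lambda>x. a * f x + b * g x) x = a * P t f x + b * P t g x) \<and>
     (\<forall>f\<in>L2 M. AE x in M. P 0 f x = f x) \<and>
     (\<forall>s\<ge>0. \<forall>t\<ge>0. \<forall>f\<in>L2 M. AE x in M. P (s + t) f x = P s (P t f) x) \<and>
     (\<forall>f\<in>L2 M. ((\<lambda>t. L2_norm M (\<lambda>x. P t f x - f x)) \<longlongrightarrow> 0) (at_right 0))"

definition generator ::
    "'a measure \<Rightarrow> (real \<Rightarrow> ('a \<Rightarrow> real) \<Rightarrow> 'a \<Rightarrow> real) \<Rightarrow> (('a \<Rightarrow> real) \<times> ('a \<Rightarrow> real)) set" where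
  "generator M P = {(f, g). f \<in> L2 M \<and> g \<in> L2 M \<and>
     ((\<lambda>t. L2_norm M (\<lambda>x. (P t f x - f x) / t - g x)) \<longlongrightarrow> 0) (at_right 0)}"

section \<open>The sub-Laplacian and its heat kernel\<close>

definition pderiv_at :: "'a::euclidean_space \<Rightarrow> ('a \<Rightarrow> real) \<Rightarrow> 'a \<Rightarrow> real" where
  "pderiv_at v f q = frechet_derivative f (at q) v"

fun Ck :: "nat \<Rightarrow> ('a::euclidean_space \<Rightarrow> real) \<Rightarrow> bool" where
  "Ck 0 f \<longleftrightarrow> continuous_on UNIV f"
| "Ck (Suc k) f \<longleftrightarrow> (\<forall>q. f differentiable (at q)) \<and> (\<forall>v. Ck k (pderiv_at v f))"

definition test_function :: "('a::euclidean_space \<Rightarrow> real) \<Rightarrow> bool" where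
  "test_function f \<longleftrightarrow> (\<forall>k. Ck k f) \<and> compact (closure {q. f q \<noteq> 0})"

definition heis_X :: "'n::finite \<Rightarrow> ('n heis \<Rightarrow> real) \<Rightarrow> 'n heis \<Rightarrow> real" where
  "heis_X i f = (\<lambda>(x, y, z).
     pderiv_at (axis i 1, 0, 0) f (x, y, z) + 2 * y $ i * pderiv_at (0, 0, 1) f (x, y, z))"

definition heis_Y :: "'n::finite \<Rightarrow> ('n heis \<Rightarrow> real) \<Rightarrow> 'n heis \<Rightarrow> real" where
  "heis_Y i f = (\<lambda>(x, y, z).
     pderiv_at (0, axis i 1, 0) f (x, y, z) - 2 * x $ i * pderiv_at (0, 0, 1) f (x, y, z))"

definition sublap :: "('n::finite heis \<Rightarrow> real) \<Rightarrow> 'n heis \<Rightarrow> real" where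
  "sublap f q = (\<Sum>i\<in>UNIV. heis_X i (heis_X i f) q + heis_Y i (heis_Y i f) q)"

text \<open>The graph of the self-adjoint operator \<open>\<Delta>\<close> on \<open>L\<^sup>2(H\<^sup>n)\<close>: the differential operator is
  essentially self-adjoint on test functions, so its self-adjoint realisation is the closure
  of its restriction to them.\<close>

definition sublap_graph :: "(('n::finite heis \<Rightarrow> real) \<times> ('n heis \<Rightarrow> real)) set" where
  "sublap_graph = {(f, g). f \<in> L2 lborel \<and> g \<in> L2 lborel \<and>
     (\<exists>\<phi>. (\<forall>k::nat. test_function (\<phi> k)) \<and>
        (\<lambda>k. L2_norm lborel (\<lambda>q. \<phi> k q - f q)) \<longlonglongrightarrow> 0 \<and>
        (\<lambda>k. L2_norm lborel (\<lambda>q. sublap (\<phi> k) q - g q)) \<longlonglongrightarrow> 0)}"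

text \<open>\<open>P\<close> is the heat semigroup \<open>t \<mapsto> e\<^bsup>t\<Delta>\<^esup>\<close>, i.e. the strongly continuous contraction semigroup
  generated by \<open>\<Delta>\<close>. It is unique up to null sets.\<close>

definition heat_semigroup :: "(real \<Rightarrow> ('n::finite heis \<Rightarrow> real) \<Rightarrow> 'n heis \<Rightarrow> real) \<Rightarrow> bool" where
  "heat_semigroup P \<longleftrightarrow> contraction_semigroup lborel P \<and> generator lborel P = sublap_graph"

text \<open>\<open>h\<close> is the heat kernel: \<open>(q\<^sub>1, q\<^sub>2) \<mapsto> h t (q\<^sub>1\<inverse> \<star> q\<^sub>2)\<close> is the integral kernel of \<open>e\<^bsup>t\<Delta>\<^esup>\<close>. Continuity
  selects the usual (smooth) version, so that \<open>h\<close> is unique on positive times.\<close>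

definition heat_kernel :: "(real \<Rightarrow> 'n::finite heis \<Rightarrow> real) \<Rightarrow> bool" where
  "heat_kernel h \<longleftrightarrow>
     continuous_on ({0<..} \<times> UNIV) (\<lambda>(t, q). h t q) \<and>
     (\<exists>P. heat_semigroup P \<and>
        (\<forall>t>0. \<forall>f\<in>L2 lborel. AE q1 in lborel.
           integrable lborel (\<lambda>q2. h t (heis_inv q1 \<star> q2) * f q2) \<and>
           P t f q1 = (LINT q2|lborel. h t (heis_inv q1 \<star> q2) * f q2)))"

text \<open>The kernel \<open>G\<^sub>\<alpha>\<close> built from the heat kernel \<open>h\<close>. The integral diverges only on the diagonal
  \<open>q1 = q2\<close>, where the value is \<open>0\<close> by the convention for integrals.\<close>

definition G_kernel ::
    "(real \<Rightarrow> 'n::finite heis \<Rightarrow> real) \<Rightarrow> real \<Rightarrow> 'n heis \<Rightarrow> 'n heis \<Rightarrow> real" where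
  "G_kernel h \<alpha> q1 q2 =
     1 / Gamma \<alpha> * (LINT t:{0<..}|lborel. t powr (\<alpha> - 1) * h t (heis_inv q1 \<star> q2))"

section \<open>White noise\<close>

definition centered_gaussian :: "'w measure \<Rightarrow> ('w \<Rightarrow> real) \<Rightarrow> bool" where
  "centered_gaussian M Y \<longleftrightarrow> Y \<in> borel_measurable M \<and>
     ((AE \<omega> in M. Y \<omega> = 0) \<or> (\<exists>\<sigma>>0. distributed M lborel Y (normal_density 0 \<sigma>)))"

definition centered_gaussian_family :: "'w measure \<Rightarrow> 'i set \<Rightarrow> ('i \<Rightarrow> 'w \<Rightarrow> real) \<Rightarrow> bool" where
  "centered_gaussian_family M I X \<longleftrightarrow>
     (\<forall>J c. finite J \<and> J \<subseteq> I \<longrightarrow> centered_gaussian M (\<lambda>\<omega>. \<Sum>j\<in>J. c j * X j \<omega>))"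

definition white_noise :: "'w measure \<Rightarrow> 'b measure \<Rightarrow> (('b \<Rightarrow> real) \<Rightarrow> 'w \<Rightarrow> real) \<Rightarrow> bool" where
  "white_noise M N W \<longleftrightarrow> centered_gaussian_family M (L2 N) W \<and>
     (\<forall>f\<in>L2 N. \<forall>g\<in>L2 N. (LINT \<omega>|M. W f \<omega> * W g \<omega>) = (LINT p|N. f p * g p))"

text \<open>The integral \<open>\<integral> f dW\<close>, defined for square integrable \<open>f\<close>; as for the other integrals of the
  library, its value is \<open>0\<close> for integrands outside its domain.
  The integrands of \<open>W_field\<close> below are square integrable when \<open>(n + 1) / 2 < \<alpha> < n / 2 + 1\<close>.\<close>

definition wiener_integral :: "'b measure \<Rightarrow> (('b \<Rightarrow> real) \<Rightarrow> 'w \<Rightarrow> real) \<Rightarrow> ('b \<Rightarrow> real) \<Rightarrow> 'w \<Rightarrow> real" where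
  "wiener_integral N W f = (if f \<in> L2 N then W f else (\<lambda>_. 0))"

abbreviation time_space :: "(real \<times> 'n::finite heis) measure" where
  "time_space \<equiv> restrict_space lborel {0..} \<Otimes>\<^sub>M lborel"

definition W_field ::
    "(real \<Rightarrow> 'n::finite heis \<Rightarrow> real) \<Rightarrow> ((real \<times> 'n heis \<Rightarrow> real) \<Rightarrow> 'w \<Rightarrow> real) \<Rightarrow> real \<Rightarrow>
     real \<Rightarrow> 'n heis \<Rightarrow> 'w \<Rightarrow> real" where
  "W_field h W \<alpha> t x = wiener_integral time_space W
     (\<lambda>(r, q). indicator {0..t} r * (G_kernel h \<alpha> x q - G_kernel h \<alpha> heis_e q))"

definition equal_in_law ::
    "'w measure \<Rightarrow> 'i set \<Rightarrow> ('i \<Rightarrow> 'w \<Rightarrow> real) \<Rightarrow> ('i \<Rightarrow> 'w \<Rightarrow> real) \<Rightarrow> bool" where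
  "equal_in_law M I X Y \<longleftrightarrow>
     (\<forall>i\<in>I. X i \<in> borel_measurable M \<and> Y i \<in> borel_measurable M) \<and>
     distr M (\<Pi>\<^sub>M i\<in>I. borel) (\<lambda>\<omega>. \<lambda>i\<in>I. X i \<omega>) = distr M (\<Pi>\<^sub>M i\<in>I. borel) (\<lambda>\<omega>. \<lambda>i\<in>I. Y i \<omega>)"

end

theory Submission
  imports Defs
begin

text \<open>
  The dilation \<open>f \<mapsto> f \<circ> \<delta>\<^sub>\<lambda>\<close> preserves test functions and intertwines \<open>\<Delta>\<close> with \<open>\<lambda>\<^sup>2 \<Delta>\<close>. A contraction
  semigroup is determined by its generator, so \<open>e\<^bsup>t\<Delta>\<^esup>\<close> agrees with \<open>e\<^bsup>\<lambda>\<^sup>2t\<Delta>\<^esup>\<close> conjugated by the dilation;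
  testing the two continuous kernels against bump functions gives
  \<open>h\<^sub>t = \<lambda>\<^bsup>2n+2\<^esup> h\<^bsub>\<lambda>\<^sup>2t\<^esub> \<circ> \<delta>\<^sub>\<lambda>\<close>, since \<open>\<delta>\<^sub>\<lambda>\<close> has Jacobian \<open>\<lambda>\<^bsup>2n+2\<^esup>\<close>. Substituting \<open>t \<mapsto> \<lambda>\<^sup>2t\<close> shows that
  \<open>G\<^sub>\<alpha>\<close> is homogeneous of degree \<open>2\<alpha> - (2n+2)\<close>, so the covariance of the field
  is multiplied by \<open>\<lambda>\<^bsup>4\<alpha>-2(n+1)\<^esup>\<close>. A centered Gaussian family is determined in law by its
  covariance, through the uniqueness of characteristic functions.
\<close>

subsection \<open>Contraction semigroups\<close>

text \<open>Elements of \<open>L2\<close> are functions rather than classes, and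
  \<open>heat_kernel\<close> only supplies some semigroup \<open>P\<close>, known up to null sets.
  Operator identities are therefore asserted almost everywhere, and it is the continuity of
  \<open>h\<close> that turns them into identities at every point, as the time integral in
  \<open>G_kernel\<close> requires. The two semigroups are compared on the domain of the generator
  only. It contains the test functions, and these suffice to identify a continuous kernel. For this
  comparison one inclusion between the generators is enough. \<open>wiener_integral\<close> has the
  default value 0 at integrands that are not square integrable. The argument therefore shows that
  dilation both preserves and reflects square integrability, so that the two fields take the default
  value at the same indices. \<open>Levy_uniqueness\<close> speaks of laws on the real line, whereas
  equality in law of the fields concerns joint laws of finitely many values. This is what shapes the
  passage from characteristic functions to laws.\<close>

lemma L2D: "f \<in> L2 M \<Longrightarrow> f \<in> borel_measurable M" "f \<in> L2 M \<Longrightarrow> integrable M (\<lambda>x. (f x)\<^sup>2)"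
  by (auto simp: L2_def)

lemma L2_mult_integrable:
  assumes "f \<in> L2 M" "g \<in> L2 M"
  shows "integrable M (\<lambda>x. f x * g x)"
proof (rule Bochner_Integration.integrable_bound)
  show "integrable M (\<lambda>x. (f x)\<^sup>2 + (g x)\<^sup>2)"
    using assms by (auto simp: L2_def)
  show "(\<lambda>x. f x * g x) \<in> borel_measurable M"
    using assms by (auto simp: L2_def)
  have "\<bar>a * b\<bar> \<le> a\<^sup>2 + b\<^sup>2" for a b :: real
  proof -
    have "2 * (\<bar>a\<bar> * \<bar>b\<bar>) \<le> a\<^sup>2 + b\<^sup>2" using sum_squares_bound[of "\<bar>a\<bar>" "\<bar>b\<bar>"] by simp
    moreover have "0 \<le> \<bar>a\<bar> * \<bar>b\<bar>" by simp
    ultimately show ?thesis unfolding abs_mult by linarith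
  qed
  then show "AE x in M. norm (f x * g x) \<le> norm ((f x)\<^sup>2 + (g x)\<^sup>2)"
    by simp
qed

lemma L2_lincomb:
  assumes "f \<in> L2 M" "g \<in> L2 M"
  shows "(\<lambda>x. a * f x + b * g x) \<in> L2 M"
proof -
  have "integrable M (\<lambda>x. a\<^sup>2 * (f x)\<^sup>2 + b\<^sup>2 * (g x)\<^sup>2 + 2 * a * b * (f x * g x))"
    using assms L2_mult_integrable[OF assms] by (auto simp: L2_def)
  then have "integrable M (\<lambda>x. (a * f x + b * g x)\<^sup>2)"
    by (simp add: power2_eq_square algebra_simps)
  then show ?thesis using assms by (auto simp: L2_def)
qed

lemma L2_diff: "f \<in> L2 M \<Longrightarrow> g \<in> L2 M \<Longrightarrow> (\<lambda>x. f x - g x) \<in> L2 M"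
  using L2_lincomb[of f M g 1 "-1"] by simp

lemma L2_add: "f \<in> L2 M \<Longrightarrow> g \<in> L2 M \<Longrightarrow> (\<lambda>x. f x + g x) \<in> L2 M"
  using L2_lincomb[of f M g 1 1] by simp

lemma L2_cmult: "f \<in> L2 M \<Longrightarrow> (\<lambda>x. c * f x) \<in> L2 M"
  using L2_lincomb[of f M f c 0] by simp

lemma L2_norm_nonneg [simp]: "0 \<le> L2_norm M f"
  by (simp add: L2_norm_def)

lemma L2_norm_power2: "(L2_norm M f)\<^sup>2 = (LINT x|M. (f x)\<^sup>2)"
  by (simp add: L2_norm_def)

lemma L2_norm_cong_AE:
  assumes "f \<in> borel_measurable M" "g \<in> borel_measurable M" "AE x in M. f x = g x"
  shows "L2_norm M f = L2_norm M g"
  unfolding L2_norm_def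
  by (rule arg_cong[where f=sqrt], rule integral_cong_AE) (use assms in auto)

lemma L2_norm_eq_0:
  assumes "f \<in> L2 M" "L2_norm M f = 0"
  shows "AE x in M. f x = 0"
proof -
  have "(LINT x|M. (f x)\<^sup>2) = 0" using assms L2_norm_power2[of M f] by simp
  then show ?thesis
    using assms integral_nonneg_eq_0_iff_AE[of M "\<lambda>x. (f x)\<^sup>2"] by (auto simp: L2_def)
qed

lemma L2_norm_cmult: "L2_norm M (\<lambda>x. c * f x) = \<bar>c\<bar> * L2_norm M f"
  by (simp add: L2_norm_def power_mult_distrib real_sqrt_mult)

text \<open>Minkowski without a separate Cauchy-Schwarz inequality: with a and b the two seminorms,
  (u + v)^2 is bounded by (1 + b/a) u^2 + (1 + a/b) v^2. These weights are optimal, since the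
  integral of the bound is exactly (a + b)^2. They divide by the seminorms, so the case of a
  vanishing one is treated apart, where the function is 0 almost everywhere.\<close>

lemma L2_norm_add:
  assumes "f \<in> L2 M" "g \<in> L2 M"
  shows "L2_norm M (\<lambda>x. f x + g x) \<le> L2_norm M f + L2_norm M g"
proof -
  let ?a = "L2_norm M f" and ?b = "L2_norm M g"
  consider "?a = 0" | "?b = 0" | "?a > 0" "?b > 0"
    using L2_norm_nonneg[of M f] L2_norm_nonneg[of M g] by linarith
  then show ?thesis
  proof cases
    case 1
    then have "L2_norm M (\<lambda>x. f x + g x) = ?b"
      using L2_norm_eq_0[OF assms(1)] assms by (intro L2_norm_cong_AE) (auto simp: L2_def)
    then show ?thesis using 1 by simp
  next
    case 2
    then have "L2_norm M (\<lambda>x. f x + g x) = ?a"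
      using L2_norm_eq_0[OF assms(2)] assms by (intro L2_norm_cong_AE) (auto simp: L2_def)
    then show ?thesis using 2 by simp
  next
    case 3
    have pw: "(u + v)\<^sup>2 \<le> (1 + ?b / ?a) * u\<^sup>2 + (1 + ?a / ?b) * v\<^sup>2" for u v :: real
    proof -
      have "0 \<le> (?b * u - ?a * v)\<^sup>2 / (?a * ?b)" using 3 by simp
      also have "\<dots> = (1 + ?b / ?a) * u\<^sup>2 + (1 + ?a / ?b) * v\<^sup>2 - (u + v)\<^sup>2"
        using 3 by (simp add: field_simps power2_eq_square)
      finally show ?thesis by simp
    qed
    have i: "integrable M (\<lambda>x. (1 + ?b / ?a) * (f x)\<^sup>2)" "integrable M (\<lambda>x. (1 + ?a / ?b) * (g x)\<^sup>2)"
      using assms by (auto simp: L2_def)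
    have "(L2_norm M (\<lambda>x. f x + g x))\<^sup>2 \<le> (LINT x|M. (1 + ?b / ?a) * (f x)\<^sup>2 + (1 + ?a / ?b) * (g x)\<^sup>2)"
      unfolding L2_norm_power2
      by (rule integral_mono) (use i L2_add[OF assms] pw in \<open>auto simp: L2_def simp del: integrable_mult_left_iff\<close>)
    also have "\<dots> = (1 + ?b / ?a) * ?a\<^sup>2 + (1 + ?a / ?b) * ?b\<^sup>2"
      using Bochner_Integration.integral_add[OF i] by (simp add: L2_norm_power2)
    also have "\<dots> = (?a + ?b)\<^sup>2"
      using 3 by (simp add: field_simps power2_eq_square)
    finally show ?thesis
      using power2_le_imp_le L2_norm_nonneg by (metis add_nonneg_nonneg)
  qed
qed

lemma L2_norm_minus_commute: "L2_norm M (\<lambda>x. f x - g x) = L2_norm M (\<lambda>x. g x - f x)"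
  by (simp add: L2_norm_def power2_commute)

lemma L2_norm_diff:
  assumes "f \<in> L2 M" "g \<in> L2 M"
  shows "L2_norm M (\<lambda>x. f x - g x) \<le> L2_norm M f + L2_norm M g"
  using L2_norm_add[OF assms(1) L2_cmult[OF assms(2), of "-1"]] L2_norm_cmult[of M "-1" g] by simp

lemma L2_norm_diff_triangle:
  assumes "f \<in> L2 M" "g \<in> L2 M" "k \<in> L2 M"
  shows "L2_norm M (\<lambda>x. f x - k x) \<le> L2_norm M (\<lambda>x. f x - g x) + L2_norm M (\<lambda>x. g x - k x)"
  using L2_norm_add[OF L2_diff[OF assms(1,2)] L2_diff[OF assms(2,3)]] by simp

text \<open>Continuous induction along [0, t] for a function whose upper right derivative is at most
  0. Left limits carry a bound up to a supremum, and the right increments carry it beyond.\<close>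

lemma real_right_derivative_zero:
  fixes u :: "real \<Rightarrow> real"
  assumes t: "0 \<le> t" and u0: "u 0 \<le> 0"
    and left: "\<And>s. 0 < s \<Longrightarrow> s \<le> t \<Longrightarrow> (u \<longlongrightarrow> u s) (at_left s)"
    and right: "\<And>s e. 0 \<le> s \<Longrightarrow> s < t \<Longrightarrow> 0 < e \<Longrightarrow> \<forall>\<^sub>F \<tau> in at_right 0. u (s + \<tau>) \<le> u s + e * \<tau>"
  shows "u t \<le> 0"
proof -
  have main: "u t \<le> e * t" if e: "e > 0" for e
  proof -
    \<comment> \<open>The times up to which \<open>u\<close> has stayed below the line of slope
      \<open>e\<close>. The supremum of this set is shown to be \<open>t\<close>.\<close>
    define S where "S = {s \<in> {0..t}. \<forall>r\<in>{0..s}. u r \<le> e * r}"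
    have 0: "0 \<in> S" using t u0 by (auto simp: S_def)
    have bdd: "bdd_above S" by (rule bdd_aboveI[of _ t]) (auto simp: S_def)
    define m where "m = Sup S"
    have m: "0 \<le> m" "m \<le> t"
    proof -
    show "0 \<le> m" unfolding m_def by (rule cSup_upper[OF 0 bdd])
    show "m \<le> t" unfolding m_def by (rule cSup_least) (use 0 in \<open>auto simp: S_def\<close>)
  qed
    have below: "u r \<le> e * r" if "0 \<le> r" "r < m" for r
    proof -
      have "\<exists>s\<in>S. r < s"
        by (rule less_cSupD) (use that 0 in \<open>auto simp: m_def\<close>)
      then obtain s where "s \<in> S" "r < s" by blast
      then show ?thesis using that by (auto simp: S_def)
    qed
    have at_m: "u m \<le> e * m"
    proof (cases "m = 0")
      case False
      then have "0 < m" using m by simp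
      have "((\<lambda>r. e * r) \<longlongrightarrow> e * m) (at_left m)" by (intro tendsto_intros)
      moreover have "\<forall>\<^sub>F r in at_left m. u r \<le> e * r"
        using eventually_at_left_real[OF \<open>0 < m\<close>] by eventually_elim (use below in auto)
      ultimately show ?thesis
        using tendsto_le[OF _ _ left[OF \<open>0 < m\<close> m(2)]] by (simp add: trivial_limit_at_left_real)
    qed (use u0 in simp)
    have "m = t"
    proof (rule ccontr)
      assume "m \<noteq> t"
      then have "m < t" using m by simp
      from right[OF m(1) this e] obtain b where b: "b > 0"
        "\<And>\<tau>. 0 < \<tau> \<Longrightarrow> \<tau> < b \<Longrightarrow> u (m + \<tau>) \<le> u m + e * \<tau>"
        by (auto simp: eventually_at_right_field)
      define d where "d = min (b / 2) (t - m)"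
      have d: "0 < d" "d < b" "m + d \<le> t" using b \<open>m < t\<close> by (auto simp: d_def)
      have "m + d \<in> S"
        unfolding S_def
      proof (safe)
        fix r assume r: "r \<in> {0..m + d}"
        consider "r < m" | "r = m" | "m < r" by linarith
        then show "u r \<le> e * r"
        proof cases
          case 3
          then have "u (m + (r - m)) \<le> u m + e * (r - m)" using b(2)[of "r - m"] r d by auto
          then show ?thesis using at_m by (simp add: algebra_simps)
        qed (use below at_m r in auto)
      qed (use m d in auto)
      then have "m + d \<le> m" unfolding m_def using bdd by (intro cSup_upper)
      then show False using d by simp
    qed
    then show ?thesis using at_m by simp
  qed
  show ?thesis
  proof (rule field_le_epsilon)
    fix e :: real assume "e > 0"
    \<comment> \<open>Dividing by \<open>t + 1\<close> rather than by \<open>t\<close> also covers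
      \<open>t = 0\<close>.\<close>
    then have "u t \<le> (e / (t + 1)) * t" using main[of "e / (t + 1)"] t by simp
    also have "\<dots> \<le> e" using t \<open>e > 0\<close> by (simp add: field_simps)
    finally show "u t \<le> 0 + e" by simp
  qed
qed

section \<open>Contraction semigroups and their generators\<close>

context
  fixes M :: "'a measure" and P
  assumes P: "contraction_semigroup M P"
begin

lemma semigroup_L2: "0 \<le> t \<Longrightarrow> f \<in> L2 M \<Longrightarrow> P t f \<in> L2 M"
  and semigroup_contraction: "0 \<le> t \<Longrightarrow> f \<in> L2 M \<Longrightarrow> L2_norm M (P t f) \<le> L2_norm M f"
  and semigroup_lincomb: "0 \<le> t \<Longrightarrow> f \<in> L2 M \<Longrightarrow> g \<in> L2 M \<Longrightarrow>
    AE x in M. P t (\<lambda>x. a * f x + b * g x) x = a * P t f x + b * P t g x"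
  and semigroup_0: "f \<in> L2 M \<Longrightarrow> AE x in M. P 0 f x = f x"
  and semigroup_add: "0 \<le> s \<Longrightarrow> 0 \<le> t \<Longrightarrow> f \<in> L2 M \<Longrightarrow> AE x in M. P (s + t) f x = P s (P t f) x"
  and semigroup_continuous: "f \<in> L2 M \<Longrightarrow> ((\<lambda>t. L2_norm M (\<lambda>x. P t f x - f x)) \<longlongrightarrow> 0) (at_right 0)"
  using P by (auto simp: contraction_semigroup_def)

lemma semigroup_diff:
  assumes "0 \<le> t" "f \<in> L2 M" "g \<in> L2 M"
  shows "AE x in M. P t (\<lambda>x. f x - g x) x = P t f x - P t g x"
  using semigroup_lincomb[OF assms, of 1 "-1"] by simp

lemma semigroup_norm_diff:
  assumes "0 \<le> t" "f \<in> L2 M" "g \<in> L2 M"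
  shows "L2_norm M (\<lambda>x. P t f x - P t g x) \<le> L2_norm M (\<lambda>x. f x - g x)"
proof -
  note L2 = semigroup_L2[OF assms(1,2)] semigroup_L2[OF assms(1,3)]
    semigroup_L2[OF assms(1) L2_diff[OF assms(2,3)]]
  have "L2_norm M (\<lambda>x. P t f x - P t g x) = L2_norm M (P t (\<lambda>x. f x - g x))"
    using semigroup_diff[OF assms] by (intro L2_norm_cong_AE L2D L2_diff L2) auto
  then show ?thesis using semigroup_contraction[OF assms(1) L2_diff[OF assms(2,3)]] by simp
qed

text \<open>\<open>P t\<close> acts on functions, so compatibility with almost everywhere equality
  has to be derived. It comes from linearity and contraction, applied to a difference of seminorm
  0.\<close>

lemma semigroup_cong_AE:
  assumes "0 \<le> t" "f \<in> L2 M" "g \<in> L2 M" "AE x in M. f x = g x"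
  shows "AE x in M. P t f x = P t g x"
proof -
  have "L2_norm M (\<lambda>x. f x - g x) = L2_norm M (\<lambda>x. 0)"
    using assms by (intro L2_norm_cong_AE) (auto simp: L2_def)
  then have "L2_norm M (\<lambda>x. P t f x - P t g x) = 0"
    using semigroup_norm_diff[OF assms(1-3)] L2_norm_cmult[of M 0 f]
    by (intro antisym[OF _ L2_norm_nonneg]) simp
  then have "AE x in M. P t f x - P t g x = 0"
    using semigroup_L2[OF assms(1)] assms(2,3) by (intro L2_norm_eq_0 L2_diff)
  then show ?thesis by simp
qed

lemma semigroup_commute:
  assumes "0 \<le> s" "0 \<le> t" "f \<in> L2 M"
  shows "AE x in M. P s (P t f) x = P t (P s f) x"
  using semigroup_add[OF assms(1,2,3)] semigroup_add[OF assms(2,1,3)]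
  by eventually_elim (simp add: add.commute)

text \<open>\<open>P s\<close> commutes with the difference quotients and contracts, so the error of
  the quotient at \<open>P s f\<close> is at most the error at \<open>f\<close>.\<close>

lemma generator_semigroup:
  assumes fg: "(f, g) \<in> generator M P" and s: "0 \<le> s"
  shows "(P s f, P s g) \<in> generator M P"
proof -
  have f: "f \<in> L2 M" and g: "g \<in> L2 M"
    and lim: "((\<lambda>t. L2_norm M (\<lambda>x. (P t f x - f x) / t - g x)) \<longlongrightarrow> 0) (at_right 0)"
    using fg by (auto simp: generator_def)
  have Pf: "P s f \<in> L2 M" and Pg: "P s g \<in> L2 M" using f g s semigroup_L2 by auto
  have "((\<lambda>t. L2_norm M (\<lambda>x. (P t (P s f) x - P s f x) / t - P s g x)) \<longlongrightarrow> 0) (at_right 0)"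
  proof (rule tendsto_sandwich[OF _ _ tendsto_const lim])
    show "\<forall>\<^sub>F t in at_right 0. L2_norm M (\<lambda>x. (P t (P s f) x - P s f x) / t - P s g x)
        \<le> L2_norm M (\<lambda>x. (P t f x - f x) / t - g x)"
      using eventually_at_right_less[of 0]
    proof eventually_elim
      case (elim t)
      let ?D = "\<lambda>x. (1 / t) * (P t f x - f x) + (-1) * g x"
      have Ptf: "P t f \<in> L2 M" and d: "(\<lambda>x. P t f x - f x) \<in> L2 M"
        using elim f semigroup_L2[of t f] L2_diff by auto
      have D: "?D \<in> L2 M" by (rule L2_lincomb[OF d g])
      have "AE x in M. P s ?D x = (P t (P s f) x - P s f x) / t - P s g x"
        using semigroup_lincomb[OF s d g, of "1/t" "-1"] semigroup_diff[OF s Ptf f]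
          semigroup_commute[OF s _ f, of t] elim
        by auto
      moreover have "(\<lambda>x. (P t (P s f) x - P s f x) / t - P s g x) \<in> borel_measurable M"
        using L2D(1)[OF Pf] L2D(1)[OF Pg] L2D(1)[OF semigroup_L2[of t, OF _ Pf]] elim by auto
      ultimately have "L2_norm M (\<lambda>x. (P t (P s f) x - P s f x) / t - P s g x) = L2_norm M (P s ?D)"
        using L2D(1)[OF semigroup_L2[OF s D]] by (intro L2_norm_cong_AE) auto
      then show ?case using semigroup_contraction[OF s D] by simp
    qed
  qed simp
  then show ?thesis using Pf Pg by (simp add: generator_def)
qed

end

text \<open>The curve \<open>s \<mapsto> Q (t - s) (P s f)\<close> joins \<open>Q t f\<close> to \<open>P t f\<close> and has vanishing right derivative.\<close>

lemma contraction_semigroup_unique: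
  assumes P: "contraction_semigroup M P" and Q: "contraction_semigroup M Q"
    and sub: "generator M P \<subseteq> generator M Q"
    and fg: "(f, g) \<in> generator M P" and t: "0 \<le> t"
  shows "AE x in M. P t f x = Q t f x"
proof -
  have f: "f \<in> L2 M" using fg by (auto simp: generator_def)
  note PL = semigroup_L2[OF P] and QL = semigroup_L2[OF Q]
  have Pf: "P s f \<in> L2 M" if "0 \<le> s" for s using PL that f by auto
  define v where "v s = Q (t - s) (P s f)" for s
  have v: "v s \<in> L2 M" if "0 \<le> s" "s \<le> t" for s
    unfolding v_def using that Pf QL by auto
  \<comment> \<open>The distance of the curve from its starting point. Estimating this real function
    replaces the differentiation of a curve with values in L2.\<close>
  define u where "u s = L2_norm M (\<lambda>x. v s x - v 0 x)" for s
  have u_diff: "\<bar>u s' - u s\<bar> \<le> L2_norm M (\<lambda>x. v s' x - v s x)"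
    if "0 \<le> s" "s \<le> t" "0 \<le> s'" "s' \<le> t" for s s'
  proof -
    have "u s' \<le> L2_norm M (\<lambda>x. v s' x - v s x) + u s" "u s \<le> L2_norm M (\<lambda>x. v s x - v s' x) + u s'"
      unfolding u_def using that t v by (intro L2_norm_diff_triangle; auto)+
    then show ?thesis using L2_norm_minus_commute[of M "v s" "v s'"] by linarith
  qed
  \<comment> \<open>Both points of the curve are \<open>Q (t - (s + \<tau>))\<close> applied to
    something, almost everywhere. Contraction strips this common factor, and what remains compares
    \<open>P\<close> and \<open>Q\<close> over the short time \<open>\<tau>\<close> from the same
    start.\<close>
  have step: "L2_norm M (\<lambda>x. v (s + \<tau>) x - v s x) \<le> L2_norm M (\<lambda>x. P \<tau> (P s f) x - Q \<tau> (P s f) x)"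
    if s: "0 \<le> s" "0 \<le> \<tau>" "s + \<tau> \<le> t" for s \<tau>
  proof -
    have t': "0 \<le> t - (s + \<tau>)" using s by simp
    have a: "AE x in M. v s x = Q (t - (s + \<tau>)) (Q \<tau> (P s f)) x"
      using semigroup_add[OF Q t' s(2) Pf[OF s(1)]] s by (simp add: v_def)
    have "AE x in M. P (s + \<tau>) f x = P \<tau> (P s f) x"
      using semigroup_add[OF P s(2,1) f] by (simp add: add.commute)
    then have b: "AE x in M. v (s + \<tau>) x = Q (t - (s + \<tau>)) (P \<tau> (P s f)) x"
      unfolding v_def by (intro semigroup_cong_AE[OF Q t']) (use s f PL in auto)
    have "L2_norm M (\<lambda>x. v (s + \<tau>) x - v s x)
      = L2_norm M (\<lambda>x. Q (t - (s + \<tau>)) (P \<tau> (P s f)) x - Q (t - (s + \<tau>)) (Q \<tau> (P s f)) x)"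
    proof (rule L2_norm_cong_AE)
      show "AE x in M. v (s + \<tau>) x - v s x =
        Q (t - (s + \<tau>)) (P \<tau> (P s f)) x - Q (t - (s + \<tau>)) (Q \<tau> (P s f)) x"
        using a b by auto
    qed (use s t' f PL QL v in \<open>auto intro!: L2D(1)[OF L2_diff]\<close>)
    also have "\<dots> \<le> L2_norm M (\<lambda>x. P \<tau> (P s f) x - Q \<tau> (P s f) x)"
      by (rule semigroup_norm_diff[OF Q t']) (use s f PL QL in auto)
    finally show ?thesis .
  qed
  have "u t \<le> 0"
  proof (rule real_right_derivative_zero[OF t])
    show "u 0 \<le> 0" by (simp add: u_def L2_norm_def)
  next
    fix s assume s: "0 < s" "s \<le> t"
    \<comment> \<open>Near \<open>s\<close> from the left the start \<open>P (s - \<tau>) f\<close>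
      moves with \<open>\<tau>\<close>, so strong continuity of \<open>Q\<close> cannot be applied
      to it directly. Replacing it by the fixed \<open>P s f\<close> costs at most the seminorm of
      \<open>P \<tau> f - f\<close>. The coefficient 3 is generous: the estimate below produces
      1.\<close>
    let ?B = "\<lambda>\<tau>. 3 * L2_norm M (\<lambda>x. P \<tau> f x - f x) + L2_norm M (\<lambda>x. Q \<tau> (P s f) x - P s f x)"
    have B: "(?B \<longlongrightarrow> 0) (at_right 0)"
      using semigroup_continuous[OF P f] semigroup_continuous[OF Q Pf[of s]] s
      by (auto intro!: tendsto_eq_intros)
    have bound: "\<bar>u (s - \<tau>) - u s\<bar> \<le> ?B \<tau>" if \<tau>: "0 < \<tau>" "\<tau> < s" for \<tau>
    proof -
      let ?p = "P (s - \<tau>) f"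
      have p: "?p \<in> L2 M" "P s f \<in> L2 M" "P \<tau> ?p \<in> L2 M" "Q \<tau> ?p \<in> L2 M" "Q \<tau> (P s f) \<in> L2 M" "P \<tau> f \<in> L2 M"
        using \<tau> s f PL QL by auto
      have ae1: "AE x in M. P s f x = P (s - \<tau>) (P \<tau> f) x"
        using semigroup_add[OF P _ _ f, of "s - \<tau>" \<tau>] \<tau> by simp
      have ae2: "AE x in M. P s f x = P \<tau> ?p x"
        using semigroup_add[OF P _ _ f, of \<tau> "s - \<tau>"] \<tau> by simp
      have "L2_norm M (\<lambda>x. P s f x - ?p x) = L2_norm M (\<lambda>x. P (s - \<tau>) (P \<tau> f) x - ?p x)"
        by (rule L2_norm_cong_AE) (use ae1 p \<tau> PL in \<open>auto intro!: L2D(1)[OF L2_diff]\<close>)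
      also have "\<dots> \<le> L2_norm M (\<lambda>x. P \<tau> f x - f x)"
        by (rule semigroup_norm_diff[OF P]) (use \<tau> p f in auto)
      finally have 1: "L2_norm M (\<lambda>x. P s f x - ?p x) \<le> L2_norm M (\<lambda>x. P \<tau> f x - f x)" .
      have "L2_norm M (\<lambda>x. P \<tau> ?p x - Q \<tau> ?p x) = L2_norm M (\<lambda>x. P s f x - Q \<tau> ?p x)"
        by (rule L2_norm_cong_AE) (use ae2 p in \<open>auto intro!: L2D(1)[OF L2_diff]\<close>)
      also have "\<dots> \<le> L2_norm M (\<lambda>x. P s f x - Q \<tau> (P s f) x) + L2_norm M (\<lambda>x. Q \<tau> (P s f) x - Q \<tau> ?p x)"
        by (rule L2_norm_diff_triangle) (use p in auto)
      also have "L2_norm M (\<lambda>x. Q \<tau> (P s f) x - Q \<tau> ?p x) \<le> L2_norm M (\<lambda>x. P s f x - ?p x)"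
        by (rule semigroup_norm_diff[OF Q]) (use p \<tau> in auto)
      finally have 2: "L2_norm M (\<lambda>x. P \<tau> ?p x - Q \<tau> ?p x) \<le> ?B \<tau>"
        using 1 L2_norm_minus_commute[of M "P s f" "Q \<tau> (P s f)"] L2_norm_nonneg[of M "\<lambda>x. P \<tau> f x - f x"]
        by linarith
      have "\<bar>u s - u (s - \<tau>)\<bar> \<le> L2_norm M (\<lambda>x. v s x - v (s - \<tau>) x)"
        by (rule u_diff) (use \<tau> s in auto)
      also have "\<dots> \<le> L2_norm M (\<lambda>x. P \<tau> ?p x - Q \<tau> ?p x)"
        using step[of "s - \<tau>" \<tau>] \<tau> s by simp
      finally show ?thesis using 2 by linarith
    qed
    have "((\<lambda>\<tau>. u (s - \<tau>) - u s) \<longlongrightarrow> 0) (at_right 0)"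
    proof (rule Lim_null_comparison[OF _ B])
      show "\<forall>\<^sub>F \<tau> in at_right 0. norm (u (s - \<tau>) - u s) \<le> ?B \<tau>"
        using eventually_at_right_real[OF s(1)] by eventually_elim (use bound in auto)
    qed
    then have "((\<lambda>\<tau>. u (s - \<tau>)) \<longlongrightarrow> u s) (at_right 0)"
      by (rule LIM_zero_cancel)
    moreover have "filterlim (\<lambda>r. s - r) (at_right 0) (at_left s)"
      unfolding filterlim_at
      by (auto intro!: tendsto_eq_intros simp: eventually_at_filter)
    ultimately have "((\<lambda>r. u (s - (s - r))) \<longlongrightarrow> u s) (at_left s)"
      by (rule filterlim_compose)
    then show "(u \<longlongrightarrow> u s) (at_left s)" by simp
  next
    fix s e :: real assume s: "0 \<le> s" "s < t" and e: "0 < e"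
    let ?p = "P s f" and ?g = "P s g"
    \<comment> \<open>\<open>P s f\<close> stays in the domain, and by the inclusion of generators
      the quotients of \<open>P\<close> and of \<open>Q\<close> at it have the same limit
      \<open>P s g\<close>. Their difference over time \<open>\<tau>\<close> is hence o(\<tau>),
      which gives the right derivative.\<close>
    have "(?p, ?g) \<in> generator M P" by (rule generator_semigroup[OF P fg s(1)])
    moreover from this have "(?p, ?g) \<in> generator M Q" using sub by auto
    ultimately have p: "?p \<in> L2 M" "?g \<in> L2 M"
      and l1: "((\<lambda>\<tau>. L2_norm M (\<lambda>x. (P \<tau> ?p x - ?p x) / \<tau> - ?g x)) \<longlongrightarrow> 0) (at_right 0)"
      and l2: "((\<lambda>\<tau>. L2_norm M (\<lambda>x. (Q \<tau> ?p x - ?p x) / \<tau> - ?g x)) \<longlongrightarrow> 0) (at_right 0)"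
      by (auto simp: generator_def)
    have ev: "\<forall>\<^sub>F \<tau> in at_right 0. L2_norm M (\<lambda>x. (P \<tau> ?p x - ?p x) / \<tau> - ?g x) +
      L2_norm M (\<lambda>x. (Q \<tau> ?p x - ?p x) / \<tau> - ?g x) < e"
      using order_tendstoD(2)[OF tendsto_add[OF l1 l2]] e by simp
    have "\<forall>\<^sub>F \<tau> in at_right 0. \<tau> \<in> {0<..<t - s}"
      using s by (intro eventually_at_right_real) simp
    with ev show "\<forall>\<^sub>F \<tau> in at_right 0. u (s + \<tau>) \<le> u s + e * \<tau>"
    proof eventually_elim
      case (elim \<tau>)
      then have \<tau>: "0 < \<tau>" "s + \<tau> \<le> t" by auto
      let ?a = "\<lambda>x. (P \<tau> ?p x - ?p x) / \<tau> - ?g x" and ?b = "\<lambda>x. (Q \<tau> ?p x - ?p x) / \<tau> - ?g x"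
      have a: "?a \<in> L2 M"
        using L2_lincomb[OF L2_diff[OF PL[OF _ p(1), of \<tau>] p(1)] p(2), of "1 / \<tau>" "-1"] \<tau> by simp
      have b: "?b \<in> L2 M"
        using L2_lincomb[OF L2_diff[OF QL[OF _ p(1), of \<tau>] p(1)] p(2), of "1 / \<tau>" "-1"] \<tau> by simp
      have "P \<tau> ?p x - Q \<tau> ?p x = \<tau> * (?a x - ?b x)" for x
        using \<tau> by (simp add: field_simps)
      then have "L2_norm M (\<lambda>x. P \<tau> ?p x - Q \<tau> ?p x) = L2_norm M (\<lambda>x. \<tau> * (?a x - ?b x))"
        by presburger
      also have "\<dots> = \<tau> * L2_norm M (\<lambda>x. ?a x - ?b x)"
        using \<tau> by (subst L2_norm_cmult) simp
      also have "\<dots> \<le> \<tau> * e"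
        using L2_norm_diff[OF a b] elim \<tau> by (intro mult_left_mono) auto
      finally have "L2_norm M (\<lambda>x. P \<tau> ?p x - Q \<tau> ?p x) \<le> e * \<tau>" by (simp add: mult.commute)
      then show ?case
        using step[of s \<tau>] u_diff[of s "s + \<tau>"] s \<tau> by auto
    qed
  qed
  then have "L2_norm M (\<lambda>x. v t x - v 0 x) = 0"
    using L2_norm_nonneg[of M "\<lambda>x. v t x - v 0 x"] by (simp add: u_def)
  then have "AE x in M. v t x - v 0 x = 0"
    using v[OF t] v[of 0] t by (intro L2_norm_eq_0 L2_diff) auto
  then have 1: "AE x in M. v t x = v 0 x" by simp
  have "AE x in M. P 0 f x = f x" by (rule semigroup_0[OF P f])
  then have 2: "AE x in M. v 0 x = Q t f x"
    unfolding v_def using semigroup_cong_AE[OF Q t] Pf f by simp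
  have "AE x in M. v t x = P t f x"
    unfolding v_def using semigroup_0[OF Q Pf[OF t]] by simp
  with 1 2 show ?thesis by auto
qed

subsection \<open>Smooth functions\<close>

lemma pderiv_at_eq: "(f has_derivative f') (at q) \<Longrightarrow> pderiv_at v f q = f' v"
  unfolding pderiv_at_def using frechet_derivative_at by metis

lemma has_derivative_pderiv_at: "f differentiable (at q) \<Longrightarrow> (f has_derivative (\<lambda>v. pderiv_at v f q)) (at q)"
  unfolding pderiv_at_def using frechet_derivative_works by blast

text \<open>Lets the closure properties below be proved from explicit derivatives, by induction on
  the order.\<close>

lemma Ck_SucI:
  assumes "\<And>q. (f has_derivative f' q) (at q)" "\<And>v. Ck k (\<lambda>q. f' q v)"
  shows "Ck (Suc k) f"
proof -
  have "pderiv_at v f = (\<lambda>q. f' q v)" for v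
    using pderiv_at_eq[OF assms(1)] by blast
  then show ?thesis using assms by (auto simp: differentiable_def)
qed

lemma Ck_Suc_differentiable: "Ck (Suc k) f \<Longrightarrow> f differentiable (at q)"
  and Ck_Suc_pderiv_at: "Ck (Suc k) f \<Longrightarrow> Ck k (pderiv_at v f)"
  by auto

lemma Ck_Suc_has_derivative: "Ck (Suc k) f \<Longrightarrow> (f has_derivative (\<lambda>v. pderiv_at v f q)) (at q)"
  by (intro has_derivative_pderiv_at) auto

lemma Ck_continuous: "Ck k f \<Longrightarrow> continuous_on UNIV f"
proof (cases k)
  case (Suc m)
  moreover assume "Ck k f"
  ultimately show ?thesis
    by (auto intro!: differentiable_imp_continuous_on simp: differentiable_on_def)
qed simp

lemma Ck_Suc_imp: "Ck (Suc k) f \<Longrightarrow> Ck k f"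
proof (induction k arbitrary: f)
  case 0
  then show ?case using Ck_continuous by (metis Ck.simps(1))
next
  case (Suc k)
  then show ?case by (metis Ck.simps(2))
qed

lemma Ck_const: "Ck k (\<lambda>_. c)"
proof (induction k arbitrary: c)
  case (Suc k)
  show ?case by (rule Ck_SucI[OF has_derivative_const Suc])
qed simp

lemma Ck_linear:
  assumes "bounded_linear f"
  shows "Ck k f"
proof (cases k)
  case 0
  then show ?thesis using assms by (auto intro: linear_continuous_on)
next
  case (Suc m)
  show ?thesis unfolding Suc
    by (rule Ck_SucI[OF bounded_linear_imp_has_derivative[OF assms] Ck_const])
qed

lemma Ck_add: "Ck k f \<Longrightarrow> Ck k g \<Longrightarrow> Ck k (\<lambda>q. f q + g q)"
proof (induction k arbitrary: f g)
  case (Suc k)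
  show ?case
    by (rule Ck_SucI[OF has_derivative_add[OF Ck_Suc_has_derivative[OF Suc.prems(1)]
            Ck_Suc_has_derivative[OF Suc.prems(2)]]])
      (use Suc in auto)
qed (auto intro: continuous_on_add)

lemma Ck_mult: "Ck k f \<Longrightarrow> Ck k g \<Longrightarrow> Ck k (\<lambda>q. f q * g q)"
proof (induction k arbitrary: f g)
  case (Suc k)
  show ?case
    by (rule Ck_SucI[OF has_derivative_mult[OF Ck_Suc_has_derivative[OF Suc.prems(1)]
            Ck_Suc_has_derivative[OF Suc.prems(2)]]])
      (use Suc Ck_Suc_imp[OF Suc.prems(1)] Ck_Suc_imp[OF Suc.prems(2)] in \<open>auto intro!: Ck_add\<close>)
qed (auto intro: continuous_on_mult)

lemma Ck_sum: "(\<And>i. i \<in> I \<Longrightarrow> Ck k (f i)) \<Longrightarrow> Ck k (\<lambda>q. \<Sum>i\<in>I. f i q)"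
  by (induction I rule: infinite_finite_induct) (auto intro: Ck_add Ck_const)

lemma Ck_compose_linear:
  assumes T: "bounded_linear T"
  shows "Ck k f \<Longrightarrow> Ck k (\<lambda>q. f (T q))"
proof (induction k arbitrary: f)
  case 0
  then show ?case
    using continuous_on_compose2[of UNIV f UNIV T] linear_continuous_on[OF T] by simp
next
  case (Suc k)
  show ?case
    by (rule Ck_SucI[OF has_derivative_compose[OF bounded_linear_imp_has_derivative[OF T]
          Ck_Suc_has_derivative[OF Suc.prems]]])
      (use Suc in auto)
qed

text \<open>The functions \<open>p(1/x) e\<^bsup>-1/x\<^esup>\<close>, extended by \<open>0\<close>, are closed under differentiation.\<close>

definition flat_exp :: "real poly \<Rightarrow> real \<Rightarrow> real" where
  "flat_exp p x = (if x > 0 then poly p (1 / x) * exp (- (1 / x)) else 0)"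

text \<open>With y = 1/x the chain rule contributes dy/dx = -y^2, and differentiating p(y) e^(-y) in
  y gives (p' - p)(y) e^(-y). The product is y^2 (p - p')(y) e^(-y).\<close>

definition flat_exp_deriv :: "real poly \<Rightarrow> real poly" where
  "flat_exp_deriv p = [:0, 0, 1:] * (p - pderiv p)"

lemma poly_exp_tendsto_0: "((\<lambda>x. poly p x * exp (- x)) \<longlongrightarrow> 0) at_top" for p :: "real poly"
proof -
  have "((\<lambda>x::real. \<Sum>i\<le>degree p. coeff p i * (x ^ i / exp x)) \<longlongrightarrow> (\<Sum>i\<le>degree p. coeff p i * 0)) at_top"
    by (intro tendsto_intros tendsto_power_div_exp_0)
  then show ?thesis
    by (simp add: poly_altdef sum_distrib_right exp_minus divide_inverse mult.assoc)
qed

lemma flat_exp_has_derivative: "(flat_exp p has_real_derivative flat_exp (flat_exp_deriv p) x) (at x)"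
proof -
  consider "x < 0" | "x = 0" | "x > 0" by linarith
  then show ?thesis
  proof cases
    case 1
    have "((\<lambda>_. 0) has_real_derivative 0) (at x)" by simp
    then have "(flat_exp p has_real_derivative 0) (at x)"
      by (rule has_field_derivative_transform_within_open[of _ _ _ "{..<0}"])
        (use 1 in \<open>auto simp: flat_exp_def\<close>)
    then show ?thesis using 1 by (simp add: flat_exp_def)
  next
    case 3
    have "((\<lambda>x. poly p (1 / x) * exp (- (1 / x))) has_real_derivative flat_exp (flat_exp_deriv p) x) (at x)"
      using 3 by (auto intro!: derivative_eq_intros DERIV_chain2[OF poly_DERIV]
          simp: flat_exp_def flat_exp_deriv_def field_simps power2_eq_square)
    then show ?thesis
      by (rule has_field_derivative_transform_within_open[of _ _ _ "{0<..}"])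
        (use 3 in \<open>auto simp: flat_exp_def\<close>)
  next
    case 2
    have "((\<lambda>y. flat_exp p y / y) \<longlongrightarrow> 0) (at 0)"
    proof (rule filterlim_split_at)
      have "\<forall>\<^sub>F y in at_left 0. flat_exp p y / y = 0"
        by (auto simp: eventually_at_filter flat_exp_def)
      then show "((\<lambda>y. flat_exp p y / y) \<longlongrightarrow> 0) (at_left 0)" by (rule tendsto_eventually)
      \<comment> \<open>The division by the increment is absorbed into the polynomial:
        \<open>pCons 0 p\<close> multiplies \<open>p\<close> by its argument, here the inverse of
        the increment.\<close>
      have "((\<lambda>y. poly (pCons 0 p) (inverse y) * exp (- inverse y)) \<longlongrightarrow> 0) (at_right 0)"
        by (rule filterlim_compose[OF poly_exp_tendsto_0 filterlim_inverse_at_top_right])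
      moreover have "\<forall>\<^sub>F y in at_right 0. poly (pCons 0 p) (inverse y) * exp (- inverse y) = flat_exp p y / y"
        by (auto simp: eventually_at_filter flat_exp_def field_simps)
      ultimately show "((\<lambda>y. flat_exp p y / y) \<longlongrightarrow> 0) (at_right 0)"
        by (rule Lim_transform_eventually)
    qed
    then show ?thesis using 2 by (simp add: DERIV_def flat_exp_def)
  qed
qed

text \<open>The polynomial is generalised in the induction because each differentiation replaces it
  by another one.\<close>

lemma Ck_flat_exp: "Ck k f \<Longrightarrow> Ck k (\<lambda>q. flat_exp p (f q))"
proof (induction k arbitrary: p)
  case 0
  have "continuous_on UNIV (flat_exp p)"
    by (rule DERIV_continuous_on) (rule flat_exp_has_derivative)
  with 0 show ?case using continuous_on_compose2[of UNIV "flat_exp p" UNIV f] by simp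
next
  case (Suc k)
  have "((\<lambda>q. flat_exp p (f q)) has_derivative (\<lambda>v. pderiv_at v f q * flat_exp (flat_exp_deriv p) (f q))) (at q)" for q
    using has_derivative_compose[OF Ck_Suc_has_derivative[OF Suc.prems]
      flat_exp_has_derivative[unfolded has_field_derivative_def]] by (simp add: mult.commute)
  then show ?case
    by (rule Ck_SucI) (use Suc Ck_Suc_imp[OF Suc.prems] in \<open>auto intro!: Ck_mult\<close>)
qed

text \<open>Knowing that the bump is nonzero exactly on the ball, and not only supported in it, lets
  a vanishing integral against it be contradicted on an open set.\<close>

lemma exists_bump:
  fixes c :: "'a::euclidean_space"
  assumes "r > 0"
  obtains \<phi> where "test_function \<phi>" "\<And>q. 0 \<le> \<phi> q" "\<And>q. \<phi> q \<noteq> 0 \<longleftrightarrow> q \<in> ball c r"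
proof
  define f where "f q = r\<^sup>2 - (norm (q - c))\<^sup>2" for q
  define \<phi> where "\<phi> q = flat_exp 1 (f q)" for q
  \<comment> \<open>The squared norm is expanded into a polynomial in the coordinates, built from
    sums and products only, so that the closure rules for \<open>Ck\<close> apply.\<close>
  have f: "f = (\<lambda>q. r\<^sup>2 + (-1) * (\<Sum>b\<in>Basis. (q \<bullet> b + - (c \<bullet> b)) * (q \<bullet> b + - (c \<bullet> b))))"
    unfolding f_def power2_norm_eq_inner by (subst euclidean_inner) (simp add: inner_diff_left)
  have "Ck k f" for k
    unfolding f
    by (intro Ck_add Ck_mult Ck_sum Ck_const Ck_linear bounded_linear_inner_left)
  then have "Ck k \<phi>" for k unfolding \<phi>_def by (rule Ck_flat_exp)
  moreover show supp: "\<phi> q \<noteq> 0 \<longleftrightarrow> q \<in> ball c r" for q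
  proof -
    have "norm (q - c) < r \<longleftrightarrow> (norm (q - c))\<^sup>2 < r\<^sup>2"
      using assms power2_less_imp_less[of "norm (q - c)" r] power_strict_mono[of "norm (q - c)" r 2] by auto
    then show ?thesis
      by (simp add: \<phi>_def flat_exp_def f_def dist_norm norm_minus_commute)
  qed
  have "{q. \<phi> q \<noteq> 0} = ball c r" by (simp only: supp Collect_mem_eq)
  ultimately show "test_function \<phi>" using assms by (simp add: test_function_def closure_ball)
  show "0 \<le> \<phi> q" for q by (simp add: \<phi>_def flat_exp_def)
qed

lemma pderiv_at_eq_0_on_open:
  assumes "open S" "q \<in> S" "\<And>q. q \<in> S \<Longrightarrow> f q = 0"
  shows "pderiv_at v f q = 0"
proof -
  have "(f has_derivative (\<lambda>_. 0)) (at q)"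
    by (rule has_derivative_transform_within_open[of "\<lambda>_. 0" _ _ _ S]) (use assms in auto)
  then show ?thesis by (rule pderiv_at_eq)
qed

lemma continuous_compact_support_L2:
  fixes f :: "'a::euclidean_space \<Rightarrow> real"
  assumes f: "continuous_on UNIV f" and K: "compact K" and 0: "\<And>q. q \<notin> K \<Longrightarrow> f q = 0"
  shows "f \<in> L2 lborel"
proof -
  have "continuous_on K (\<lambda>q. (f q)\<^sup>2)"
    using f by (auto intro!: continuous_intros intro: continuous_on_subset)
  then have "integrable lborel (\<lambda>q. indicator K q *\<^sub>R (f q)\<^sup>2)"
    by (rule borel_integrable_compact[OF K])
  moreover have "(\<lambda>q. indicator K q *\<^sub>R (f q)\<^sup>2) = (\<lambda>q. (f q)\<^sup>2)"
    using 0 by (intro ext) (auto simp: indicator_def)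
  ultimately show ?thesis
    using borel_measurable_continuous_onI[OF f] by (simp add: L2_def)
qed

subsection \<open>The sub-Laplacian\<close>

lemma heis_X_eq: "heis_X i f = (\<lambda>q. pderiv_at (axis i 1, 0, 0) f q + 2 * (fst (snd q) $ i) * pderiv_at (0, 0, 1) f q)"
  and heis_Y_eq: "heis_Y i f = (\<lambda>q. pderiv_at (0, axis i 1, 0) f q + (-2) * (fst q $ i) * pderiv_at (0, 0, 1) f q)"
  by (auto simp: heis_X_def heis_Y_def)

lemma
  fixes f :: "'n::finite heis \<Rightarrow> real"
  shows Ck_heis_X: "Ck (Suc k) f \<Longrightarrow> Ck k (heis_X i f)"
  and Ck_heis_Y: "Ck (Suc k) f \<Longrightarrow> Ck k (heis_Y i f)"
proof -
  have lin: "bounded_linear (\<lambda>q::'n heis. fst (snd q) $ i)" "bounded_linear (\<lambda>q::'n heis. fst q $ i)"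
    by (intro bounded_linear_compose[OF bounded_linear_vec_nth] bounded_linear_fst_comp bounded_linear_snd_comp bounded_linear_ident)+
  assume f: "Ck (Suc k) f"
  show "Ck k (heis_X i f)" unfolding heis_X_eq
    by (intro Ck_add Ck_mult Ck_const Ck_linear lin Ck_Suc_pderiv_at f)
  show "Ck k (heis_Y i f)" unfolding heis_Y_eq
    by (intro Ck_add Ck_mult Ck_const Ck_linear lin Ck_Suc_pderiv_at f)
qed

text \<open>The vector fields are local, so \<open>sublap f\<close> still vanishes off the closed
  support of \<open>f\<close>. The closure matters: its complement is open, and a function that is 0
  there has zero derivatives there.\<close>

lemma sublap_L2:
  assumes "test_function f"
  shows "f \<in> L2 lborel" "sublap f \<in> L2 lborel"
proof -
  let ?K = "closure {q. f q \<noteq> 0}"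
  have C: "Ck k f" for k using assms by (auto simp: test_function_def)
  have K: "compact ?K" using assms by (auto simp: test_function_def)
  have 0: "f q = 0" if "q \<in> - ?K" for q using that closure_subset[of "{q. f q \<noteq> 0}"] by auto
  show "f \<in> L2 lborel"
    by (rule continuous_compact_support_L2[OF Ck_continuous[OF C] K]) (rule 0, simp only: Compl_iff not_False_eq_True)
  have o: "open (- ?K)" by auto
  have X0: "heis_X i g q = 0" "heis_Y i g q = 0" if "q \<in> - ?K" "\<And>q. q \<in> - ?K \<Longrightarrow> g q = 0" for g q i
    using pderiv_at_eq_0_on_open[OF o that] by (simp_all add: heis_X_eq heis_Y_eq)
  have "sublap f q = 0" if "q \<notin> ?K" for q
  proof -
    have q: "q \<in> - ?K" using that by simp
    have "heis_X i (heis_X i f) q = 0" "heis_Y i (heis_Y i f) q = 0" for i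
      by (rule X0[OF q X0(1)[OF _ 0]] X0[OF q X0(2)[OF _ 0]]; assumption)+
    then show ?thesis by (simp add: sublap_def)
  qed
  moreover have "Ck 0 (sublap f)"
    unfolding sublap_def[abs_def] by (intro Ck_sum Ck_add Ck_heis_X Ck_heis_Y C)
  ultimately show "sublap f \<in> L2 lborel"
    by (rule continuous_compact_support_L2[OF Ck_continuous K, rotated])
qed

lemma test_function_sublap_graph:
  assumes "test_function f"
  shows "(f, sublap f) \<in> sublap_graph"
  unfolding sublap_graph_def using sublap_L2[OF assms] assms
  by (auto intro!: exI[of _ "\<lambda>_. f"] simp: L2_norm_def)

section \<open>Homogeneity of the vector fields under dilation\<close>

lemma heis_dil_eq: "heis_dil l = (\<lambda>q. (l *\<^sub>R fst q, l *\<^sub>R fst (snd q), l\<^sup>2 *\<^sub>R snd (snd q)))"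
  by auto

lemma bounded_linear_heis_dil: "bounded_linear (heis_dil l)"
  unfolding heis_dil_eq by (auto intro!: bounded_linear_intros)

text \<open>The derivative in z picks up \<open>l\<^sup>2\<close>, but one factor \<open>l\<close>
  of it is needed to turn the coefficient at \<open>q\<close> into the coefficient at
  \<open>heis_dil l q\<close>. Thus both terms of each field scale by \<open>l\<close>. The constant
  \<open>c\<close> allows a second application, to the output of the first.\<close>

lemma heis_X_dil:
  fixes f :: "'n::finite heis \<Rightarrow> real"
  assumes "\<And>q. f differentiable (at q)"
  shows "heis_X i (\<lambda>q. c * f (heis_dil l q)) = (\<lambda>q. (c * l) * heis_X i f (heis_dil l q))"
    and "heis_Y i (\<lambda>q. c * f (heis_dil l q)) = (\<lambda>q. (c * l) * heis_Y i f (heis_dil l q))"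
proof -
  have d: "(f has_derivative (\<lambda>v. pderiv_at v f q)) (at q)" for q
    using assms has_derivative_pderiv_at by blast
  have lin: "pderiv_at (a *\<^sub>R v) f q = a * pderiv_at v f q" for a v q
    using linear_scale[OF has_derivative_linear[OF d]] by simp
  have "((\<lambda>q. c * f (heis_dil l q)) has_derivative (\<lambda>v. c * pderiv_at (heis_dil l v) f (heis_dil l q))) (at q)" for q
    by (intro has_derivative_mult_right
        has_derivative_compose[OF bounded_linear_imp_has_derivative[OF bounded_linear_heis_dil] d])
  then have *: "pderiv_at v (\<lambda>q. c * f (heis_dil l q)) q = c * pderiv_at (heis_dil l v) f (heis_dil l q)" for v q
    by (rule pderiv_at_eq)
  have dil: "heis_dil l (axis i 1, 0, 0) = l *\<^sub>R (axis i 1, 0, 0)" "heis_dil l (0, axis i 1, 0) = l *\<^sub>R (0, axis i 1, 0)"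
    "heis_dil l (0, 0, 1) = l\<^sup>2 *\<^sub>R (0, 0, 1)" by auto
  have *: "pderiv_at (axis i 1, 0, 0) (\<lambda>q. c * f (heis_dil l q)) q = c * (l * pderiv_at (axis i 1, 0, 0) f (heis_dil l q))"
    "pderiv_at (0, axis i 1, 0) (\<lambda>q. c * f (heis_dil l q)) q = c * (l * pderiv_at (0, axis i 1, 0) f (heis_dil l q))"
    "pderiv_at (0, 0, 1) (\<lambda>q. c * f (heis_dil l q)) q = c * (l\<^sup>2 * pderiv_at (0, 0, 1) f (heis_dil l q))" for q
    by (simp_all only: * dil lin)
  have coord: "fst (snd (heis_dil l q)) $ i = l * fst (snd q) $ i" "fst (heis_dil l q) $ i = l * fst q $ i" for q
    by (simp_all add: heis_dil_eq)
  show "heis_X i (\<lambda>q. c * f (heis_dil l q)) = (\<lambda>q. (c * l) * heis_X i f (heis_dil l q))"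
    "heis_Y i (\<lambda>q. c * f (heis_dil l q)) = (\<lambda>q. (c * l) * heis_Y i f (heis_dil l q))"
    unfolding heis_X_eq heis_Y_eq * coord by (simp_all add: algebra_simps power2_eq_square)
qed

lemma sublap_dil:
  assumes "test_function f"
  shows "sublap (\<lambda>q. f (heis_dil l q)) = (\<lambda>q. l\<^sup>2 * sublap f (heis_dil l q))"
proof -
  have C: "Ck k f" for k using assms by (auto simp: test_function_def)
  have d: "f differentiable (at q)" "heis_X i f differentiable (at q)" "heis_Y i f differentiable (at q)" for i q
    by (rule Ck_Suc_differentiable[of 0]; intro Ck_heis_X Ck_heis_Y C)+
  have "heis_X i (heis_X i (\<lambda>q. f (heis_dil l q))) = (\<lambda>q. l\<^sup>2 * heis_X i (heis_X i f) (heis_dil l q))"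
    "heis_Y i (heis_Y i (\<lambda>q. f (heis_dil l q))) = (\<lambda>q. l\<^sup>2 * heis_Y i (heis_Y i f) (heis_dil l q))" for i
    using heis_X_dil(1)[OF d(1), where c=1 and i=i and l=l] heis_X_dil(1)[OF d(2), where c=l and i=i and l=l]
      heis_X_dil(2)[OF d(1), where c=1 and i=i and l=l] heis_X_dil(2)[OF d(3), where c=l and i=i and l=l]
    by (simp_all add: power2_eq_square)
  then show ?thesis by (auto simp: sublap_def sum_distrib_left distrib_left)
qed

lemma heis_dil_inverse: "l \<noteq> 0 \<Longrightarrow> heis_dil l (heis_dil (1 / l) q) = q"
  "l \<noteq> 0 \<Longrightarrow> heis_dil (1 / l) (heis_dil l q) = q"
  by (cases q; simp add: power_divide)+

lemma test_function_dil:
  assumes "test_function f" "l \<noteq> 0"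
  shows "test_function (\<lambda>q. f (heis_dil l q))"
proof -
  have C: "Ck k f" for k using assms by (auto simp: test_function_def)
  have K: "compact (closure {q. f q \<noteq> 0})" using assms by (auto simp: test_function_def)
  let ?K = "heis_dil (1 / l) ` closure {q. f q \<noteq> 0}"
  have cK: "compact ?K"
    by (intro compact_continuous_image K linear_continuous_on bounded_linear_heis_dil)
  have "{q. f (heis_dil l q) \<noteq> 0} \<subseteq> ?K"
  proof
    fix q assume "q \<in> {q. f (heis_dil l q) \<noteq> 0}"
    then have "heis_dil l q \<in> closure {q. f q \<noteq> 0}" using closure_subset by fast
    then show "q \<in> ?K" using heis_dil_inverse(2)[OF assms(2), of q] by (metis image_eqI)
  qed
  then have "bounded {q. f (heis_dil l q) \<noteq> 0}"
    by (rule bounded_subset[OF compact_imp_bounded[OF cK]])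
  then show ?thesis
    using Ck_compose_linear[OF bounded_linear_heis_dil C] by (simp add: test_function_def)
qed

subsection \<open>Dilations and Lebesgue measure\<close>

lemma heis_dil_measurable [measurable]: "heis_dil l \<in> borel_measurable borel"
  by (intro borel_measurable_continuous_onI linear_continuous_on bounded_linear_heis_dil)

text \<open>The dilation is diagonal in the standard basis, with 2n entries \<open>l\<close> and a
  single entry \<open>l\<^sup>2\<close> in the central direction (0, 0, 1). The product of the
  entries is the Jacobian.\<close>

lemma lborel_heis_dil:
  assumes "l > 0"
  shows "(lborel :: 'n::finite heis measure)
    = density (distr lborel borel (heis_dil l)) (\<lambda>_. ennreal (l ^ (2 * CARD('n) + 2)))"
proof -
  let ?B = "Basis :: 'n heis set"
  define c :: "'n heis \<Rightarrow> real" where "c j = (if j = (0, 0, 1) then l\<^sup>2 else l)" for j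
  have c: "c j \<noteq> 0" for j using assms by (simp add: c_def)
  have *: "heis_dil l q \<bullet> b = c b * (q \<bullet> b)" if "b \<in> ?B" for b q
    using that by (cases q) (auto simp: Basis_prod_def c_def zero_prod_def)
  have **: "(0 + (\<Sum>j\<in>?B. (c j * (q \<bullet> j)) *\<^sub>R j)) \<bullet> b = c b * (q \<bullet> b)" if "b \<in> ?B" for b q
    using that by (simp add: inner_sum_left inner_Basis if_distrib[of "(*) _"] cong: if_cong)
  have T: "(\<lambda>q. 0 + (\<Sum>j\<in>?B. (c j * (q \<bullet> j)) *\<^sub>R j)) = heis_dil l"
    by (rule ext, rule euclidean_eqI) (simp only: * **)
  have one: "(0, 0, 1) \<in> ?B" by (auto simp: Basis_prod_def zero_prod_def image_iff)
  have "(\<Prod>j\<in>?B. \<bar>c j\<bar>) = \<bar>c (0, 0, 1)\<bar> * (\<Prod>j\<in>?B - {(0, 0, 1)}. \<bar>c j\<bar>)"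
    by (rule prod.remove[OF _ one]) simp
  also have "(\<Prod>j\<in>?B - {(0, 0, 1)}. \<bar>c j\<bar>) = (\<Prod>j\<in>?B - {(0, 0, 1)}. l)"
    using assms by (intro prod.cong) (auto simp: c_def)
  also have "\<dots> = l ^ (2 * CARD('n))"
    using one by (simp add: card_Diff_singleton mult_2)
  finally have "(\<Prod>j\<in>?B. \<bar>c j\<bar>) = l ^ (2 * CARD('n) + 2)"
    using assms by (simp add: c_def power_add mult.commute power2_eq_square)
  with lborel_affine_euclidean[of c 0, OF c] T show ?thesis by simp
qed

context
  fixes l :: real
  assumes l: "l > 0"
begin

lemma integrable_heis_dil:
  fixes f :: "'n::finite heis \<Rightarrow> real"
  assumes [measurable]: "f \<in> borel_measurable borel"
  shows "integrable lborel (\<lambda>q. f (heis_dil l q)) \<longleftrightarrow> integrable lborel f"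
proof -
  define J where "J = l ^ (2 * CARD('n) + 2)"
  have J: "J > 0" using l by (simp add: J_def)
  have "integrable lborel f \<longleftrightarrow> integrable (density (distr lborel borel (heis_dil l)) (\<lambda>_. ennreal J)) f"
    by (subst lborel_heis_dil[OF l]) (simp only: J_def)
  also have "\<dots> \<longleftrightarrow> integrable lborel (\<lambda>q. f (heis_dil l q))"
    using J by (simp add: integrable_density integrable_distr_eq)
  finally show ?thesis by simp
qed

lemma integral_heis_dil:
  fixes f :: "'n::finite heis \<Rightarrow> real"
  assumes [measurable]: "f \<in> borel_measurable borel"
  shows "(LINT q|lborel. f q) = l ^ (2 * CARD('n) + 2) * (LINT q|lborel. f (heis_dil l q))"
proof -
  define J where "J = l ^ (2 * CARD('n) + 2)"
  have J: "J > 0" using l by (simp add: J_def)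
  have "(LINT q|lborel. f q) = (LINT q|density (distr lborel borel (heis_dil l)) (\<lambda>_. ennreal J). f q)"
    by (subst lborel_heis_dil[OF l]) (simp only: J_def)
  also have "\<dots> = J * (LINT q|lborel. f (heis_dil l q))"
    using J by (simp add: integral_density integral_distr)
  finally show ?thesis by (simp only: J_def)
qed

lemma AE_heis_dil:
  assumes "AE q::'n::finite heis in lborel. R q"
  shows "AE q::'n::finite heis in lborel. R (heis_dil l q)"
proof -
  define J where "J = l ^ (2 * CARD('n) + 2)"
  have J: "J > 0" using l by (simp add: J_def)
  have "AE q in density (distr lborel borel (heis_dil l)) (\<lambda>_. ennreal J). R q"
    using assms by (subst (asm) lborel_heis_dil[OF l]) (simp only: J_def)
  then have "AE q in distr lborel borel (heis_dil l). R q"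
    using J by (simp add: AE_density)
  then show ?thesis by (rule AE_distrD[rotated]) simp
qed

lemma L2_heis_dil:
  fixes f :: "'n::finite heis \<Rightarrow> real"
  assumes "f \<in> L2 lborel"
  shows "(\<lambda>q. f (heis_dil l q)) \<in> L2 lborel"
  using assms integrable_heis_dil[of "\<lambda>q. (f q)\<^sup>2"] by (auto simp: L2_def)

lemma L2_norm_heis_dil:
  fixes f :: "'n::finite heis \<Rightarrow> real"
  assumes "f \<in> borel_measurable borel"
  shows "L2_norm lborel f = sqrt (l ^ (2 * CARD('n) + 2)) * L2_norm lborel (\<lambda>q. f (heis_dil l q))"
  using integral_heis_dil[of "\<lambda>q. (f q)\<^sup>2"] assms by (simp add: L2_norm_def real_sqrt_mult)

text \<open>Membership in \<open>L2\<close> is asked only eventually because the semigroups are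
  controlled only at nonnegative times, while the filter is \<open>at_right 0\<close>.\<close>

lemma L2_norm_heis_dil_tendsto_0:
  fixes f :: "'b \<Rightarrow> 'n::finite heis \<Rightarrow> real"
  assumes lim: "((\<lambda>k. L2_norm lborel (f k)) \<longlongrightarrow> 0) F" and f: "\<forall>\<^sub>F k in F. f k \<in> L2 lborel"
  shows "((\<lambda>k. L2_norm lborel (\<lambda>q. f k (heis_dil l q))) \<longlongrightarrow> 0) F"
proof -
  define J where "J = sqrt (l ^ (2 * CARD('n) + 2))"
  have J: "J > 0" using l by (simp add: J_def)
  have "((\<lambda>k. L2_norm lborel (f k) / J) \<longlongrightarrow> 0) F"
    by (rule tendsto_divide_zero[OF lim])
  moreover have "\<forall>\<^sub>F k in F. L2_norm lborel (f k) / J = L2_norm lborel (\<lambda>q. f k (heis_dil l q))"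
    using f
  proof eventually_elim
    case (elim k)
    then have "f k \<in> borel_measurable borel" by (simp add: L2_def)
    from L2_norm_heis_dil[OF this, folded J_def] J show ?case by simp
  qed
  ultimately show ?thesis by (rule Lim_transform_eventually)
qed

text \<open>The graph is defined by approximation, so the intertwining relation is applied to the
  approximating test functions and passes to the limit.\<close>

lemma sublap_graph_heis_dil:
  fixes f g :: "'n::finite heis \<Rightarrow> real"
  assumes "(f, g) \<in> sublap_graph"
  shows "((\<lambda>q. f (heis_dil l q)), (\<lambda>q. l\<^sup>2 * g (heis_dil l q))) \<in> sublap_graph"
proof -
  obtain \<phi> where f: "f \<in> L2 lborel" and g: "g \<in> L2 lborel"
    and \<phi>: "\<And>k::nat. test_function (\<phi> k)"
    and lf: "(\<lambda>k. L2_norm lborel (\<lambda>q. \<phi> k q - f q)) \<longlonglongrightarrow> 0"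
    and lg: "(\<lambda>k. L2_norm lborel (\<lambda>q. sublap (\<phi> k) q - g q)) \<longlonglongrightarrow> 0"
    using assms by (auto simp: sublap_graph_def)
  have "(\<lambda>k. L2_norm lborel (\<lambda>q. \<phi> k (heis_dil l q) - f (heis_dil l q))) \<longlonglongrightarrow> 0"
    by (rule L2_norm_heis_dil_tendsto_0[OF lf always_eventually]) (intro allI L2_diff sublap_L2 \<phi> f)
  moreover have "(\<lambda>k. L2_norm lborel (\<lambda>q. l\<^sup>2 * (sublap (\<phi> k) (heis_dil l q) - g (heis_dil l q)))) \<longlonglongrightarrow> 0"
    unfolding L2_norm_cmult
    by (rule tendsto_mult_right_zero, rule L2_norm_heis_dil_tendsto_0[OF lg always_eventually])
      (intro allI L2_diff sublap_L2 \<phi> g)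
  then have "(\<lambda>k. L2_norm lborel (\<lambda>q. sublap (\<lambda>q. \<phi> k (heis_dil l q)) q - l\<^sup>2 * g (heis_dil l q))) \<longlonglongrightarrow> 0"
    by (simp add: sublap_dil[OF \<phi>] right_diff_distrib)
  moreover have "test_function (\<lambda>q. \<phi> k (heis_dil l q))" for k
    using test_function_dil[OF \<phi>] l by simp
  ultimately show ?thesis
    unfolding sublap_graph_def using L2_heis_dil f g L2_cmult by fast
qed

end

subsection \<open>Scaling of the heat semigroup\<close>

text \<open>Conjugating \<Delta> by the dilation as here gives \<Delta> divided by
  \<open>l\<^sup>2\<close>. Running time faster by the factor \<open>l\<^sup>2\<close> restores
  \<Delta> as the generator.\<close>

definition dil_semigroup ::
    "real \<Rightarrow> (real \<Rightarrow> ('n::finite heis \<Rightarrow> real) \<Rightarrow> 'n heis \<Rightarrow> real) \<Rightarrow> real \<Rightarrow> ('n heis \<Rightarrow> real) \<Rightarrow> 'n heis \<Rightarrow> real" where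
  "dil_semigroup l P t f q = P (l\<^sup>2 * t) (\<lambda>q. f (heis_dil (1 / l) q)) (heis_dil l q)"

lemma filterlim_mult_at_right_0:
  fixes c :: real
  assumes "c > 0"
  shows "filterlim (\<lambda>t. c * t) (at_right 0) (at_right 0)"
  unfolding filterlim_at using assms
  by (auto intro!: tendsto_eq_intros simp: eventually_at_filter)

lemma contraction_semigroup_dil:
  fixes P :: "real \<Rightarrow> ('n::finite heis \<Rightarrow> real) \<Rightarrow> 'n heis \<Rightarrow> real"
  assumes P: "contraction_semigroup lborel P" and l: "l > 0"
  shows "contraction_semigroup lborel (dil_semigroup l P)"
proof -
  have l': "1 / l > 0" and ln: "l \<noteq> 0" using l by auto
  have t: "0 \<le> l\<^sup>2 * t" if "0 \<le> t" for t using that by simp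
  note D = L2_heis_dil[OF l] and D' = L2_heis_dil[OF l']
  have bm: "f \<in> borel_measurable borel" if "f \<in> L2 lborel" for f :: "'n heis \<Rightarrow> real"
    using that by (simp add: L2_def)
  show ?thesis
    unfolding contraction_semigroup_def
  proof (intro conjI allI ballI impI)
    fix t :: real and f :: "'n heis \<Rightarrow> real" assume t0: "0 \<le> t" and f: "f \<in> L2 lborel"
    let ?f = "\<lambda>q. f (heis_dil (1 / l) q)"
    have Pf: "P (l\<^sup>2 * t) ?f \<in> L2 lborel" by (rule semigroup_L2[OF P t[OF t0] D'[OF f]])
    then show "dil_semigroup l P t f \<in> L2 lborel"
      unfolding dil_semigroup_def[abs_def] by (rule D)
    \<comment> \<open>The two dilations in the conjugation change the seminorm by reciprocal
      factors, the square root of the Jacobian and its inverse, so contraction survives.\<close>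
    have "sqrt (l ^ (2 * CARD('n) + 2)) * L2_norm lborel (dil_semigroup l P t f) = L2_norm lborel (P (l\<^sup>2 * t) ?f)"
      using L2_norm_heis_dil[OF l bm[OF Pf]] by (simp add: dil_semigroup_def[abs_def])
    also have "\<dots> \<le> L2_norm lborel ?f" by (rule semigroup_contraction[OF P t[OF t0] D'[OF f]])
    also have "\<dots> = sqrt (l ^ (2 * CARD('n) + 2)) * L2_norm lborel f"
      using L2_norm_heis_dil[OF l bm[OF D'[OF f]]] by (simp only: heis_dil_inverse(2)[OF ln])
    finally show "L2_norm lborel (dil_semigroup l P t f) \<le> L2_norm lborel f"
      using l by (simp del: power_add power_Suc)
  next
    fix t a b :: real and f g :: "'n heis \<Rightarrow> real"
    assume "0 \<le> t" and fg: "f \<in> L2 lborel" "g \<in> L2 lborel"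
    then show "AE q in lborel. dil_semigroup l P t (\<lambda>q. a * f q + b * g q) q =
        a * dil_semigroup l P t f q + b * dil_semigroup l P t g q"
      unfolding dil_semigroup_def
      by (intro AE_heis_dil[OF l] semigroup_lincomb[OF P t D' D'])
  next
    fix f :: "'n heis \<Rightarrow> real" assume f: "f \<in> L2 lborel"
    have "AE q in lborel. P 0 (\<lambda>q. f (heis_dil (1 / l) q)) (heis_dil l q) = f (heis_dil (1 / l) (heis_dil l q))"
      by (rule AE_heis_dil[OF l semigroup_0[OF P D'[OF f]]])
    then show "AE q in lborel. dil_semigroup l P 0 f q = f q"
      by (simp only: dil_semigroup_def heis_dil_inverse(2)[OF ln] mult_zero_right)
  next
    fix s u :: real and f :: "'n heis \<Rightarrow> real" assume "0 \<le> s" "0 \<le> u" and f: "f \<in> L2 lborel"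
    then show "AE q in lborel. dil_semigroup l P (s + u) f q = dil_semigroup l P s (dil_semigroup l P u f) q"
      using AE_heis_dil[OF l semigroup_add[OF P t t D'[OF f]]]
      by (simp only: dil_semigroup_def heis_dil_inverse(1)[OF ln] distrib_left)
  next
    fix f :: "'n heis \<Rightarrow> real" assume f: "f \<in> L2 lborel"
    let ?f = "\<lambda>q. f (heis_dil (1 / l) q)"
    have "((\<lambda>t. L2_norm lborel (\<lambda>q. P (l\<^sup>2 * t) ?f q - ?f q)) \<longlongrightarrow> 0) (at_right 0)"
      by (rule filterlim_compose[OF semigroup_continuous[OF P D'[OF f]] filterlim_mult_at_right_0]) (use l in simp)
    then have "((\<lambda>t. L2_norm lborel (\<lambda>q. P (l\<^sup>2 * t) ?f (heis_dil l q) - ?f (heis_dil l q))) \<longlongrightarrow> 0) (at_right 0)"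
    proof (rule L2_norm_heis_dil_tendsto_0[OF l])
      show "\<forall>\<^sub>F t in at_right 0. (\<lambda>q. P (l\<^sup>2 * t) ?f q - ?f q) \<in> L2 lborel"
        using eventually_at_right_less[of 0]
        by eventually_elim (intro L2_diff semigroup_L2[OF P] t D' f, simp)
    qed
    then show "((\<lambda>t. L2_norm lborel (\<lambda>q. dil_semigroup l P t f q - f q)) \<longlongrightarrow> 0) (at_right 0)"
      by (simp only: dil_semigroup_def heis_dil_inverse(2)[OF ln])
  qed
qed

text \<open>The pair dilated by \<open>1 / l\<close> lies in the generator of \<open>P\<close>. Its
  limit is read at time \<open>l\<^sup>2 * t\<close> and dilated back by \<open>l\<close>.\<close>

lemma sublap_graph_subset_generator_dil:
  fixes P :: "real \<Rightarrow> ('n::finite heis \<Rightarrow> real) \<Rightarrow> 'n heis \<Rightarrow> real"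
  assumes P: "heat_semigroup P" and l: "l > 0"
  shows "sublap_graph \<subseteq> generator lborel (dil_semigroup l P)"
proof (clarify)
  fix f g :: "'n heis \<Rightarrow> real" assume fg: "(f, g) \<in> sublap_graph"
  have l': "1 / l > 0" and ln: "l \<noteq> 0" using l by auto
  have P': "contraction_semigroup lborel P" and gen: "generator lborel P = sublap_graph"
    using P by (auto simp: heat_semigroup_def)
  let ?f = "\<lambda>q. f (heis_dil (1 / l) q)" and ?g = "\<lambda>q. (1 / l)\<^sup>2 * g (heis_dil (1 / l) q)"
  have "(?f, ?g) \<in> generator lborel P"
    unfolding gen by (rule sublap_graph_heis_dil[OF l' fg])
  then have f: "?f \<in> L2 lborel" and g: "?g \<in> L2 lborel"
    and lim: "((\<lambda>t. L2_norm lborel (\<lambda>q. (P t ?f q - ?f q) / t - ?g q)) \<longlongrightarrow> 0) (at_right 0)"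
    by (auto simp: generator_def)
  have "((\<lambda>t. L2_norm lborel (\<lambda>q. (P (l\<^sup>2 * t) ?f q - ?f q) / (l\<^sup>2 * t) - ?g q)) \<longlongrightarrow> 0) (at_right 0)"
    by (rule filterlim_compose[OF lim filterlim_mult_at_right_0]) (use l in simp)
  then have "((\<lambda>t. L2_norm lborel (\<lambda>q. (P (l\<^sup>2 * t) ?f (heis_dil l q) - ?f (heis_dil l q)) / (l\<^sup>2 * t) - ?g (heis_dil l q)))
      \<longlongrightarrow> 0) (at_right 0)"
  proof (rule L2_norm_heis_dil_tendsto_0[OF l])
    show "\<forall>\<^sub>F t in at_right 0. (\<lambda>q. (P (l\<^sup>2 * t) ?f q - ?f q) / (l\<^sup>2 * t) - ?g q) \<in> L2 lborel"
      using eventually_at_right_less[of 0]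
    proof eventually_elim
      case (elim t)
      then have "0 \<le> l\<^sup>2 * t" by simp
      from L2_lincomb[OF L2_diff[OF semigroup_L2[OF P' this f] f] g, of "1 / (l\<^sup>2 * t)" "-1"]
      show ?case by simp
    qed
  qed
  \<comment> \<open>Multiplying by \<open>l\<^sup>2\<close> compensates both the denominator
    \<open>l\<^sup>2 * t\<close> and the factor \<open>(1 / l)\<^sup>2\<close> on
    \<open>g\<close>.\<close>
  then have "((\<lambda>t. l\<^sup>2 * L2_norm lborel (\<lambda>q. (dil_semigroup l P t f q - f q) / (l\<^sup>2 * t) - (1 / l)\<^sup>2 * g q)) \<longlongrightarrow> 0) (at_right 0)"
    by (intro tendsto_mult_right_zero) (simp only: dil_semigroup_def heis_dil_inverse(2)[OF ln])
  moreover have "l\<^sup>2 * L2_norm lborel (\<lambda>q. (dil_semigroup l P t f q - f q) / (l\<^sup>2 * t) - (1 / l)\<^sup>2 * g q)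
    = L2_norm lborel (\<lambda>q. (dil_semigroup l P t f q - f q) / t - g q)" for t
  proof -
    have "l\<^sup>2 * ((dil_semigroup l P t f q - f q) / (l\<^sup>2 * t) - (1 / l)\<^sup>2 * g q) = (dil_semigroup l P t f q - f q) / t - g q" for q
    proof -
      have "l\<^sup>2 * (x / (l\<^sup>2 * t) - (1 / l)\<^sup>2 * y) = x / t - y" for x y
        using ln by (simp add: right_diff_distrib power_divide)
      then show ?thesis .
    qed
    then show ?thesis
      using L2_norm_cmult[of lborel "l\<^sup>2" "\<lambda>q. (dil_semigroup l P t f q - f q) / (l\<^sup>2 * t) - (1 / l)\<^sup>2 * g q"]
      by simp
  qed
  moreover have "f \<in> L2 lborel" "g \<in> L2 lborel" using fg by (auto simp: sublap_graph_def)
  ultimately show "(f, g) \<in> generator lborel (dil_semigroup l P)"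
    by (simp add: generator_def)
qed

lemma heat_semigroup_dil:
  fixes P :: "real \<Rightarrow> ('n::finite heis \<Rightarrow> real) \<Rightarrow> 'n heis \<Rightarrow> real"
  assumes P: "heat_semigroup P" and l: "l > 0" and \<phi>: "test_function \<phi>" and t: "0 \<le> t"
  shows "AE q in lborel. P t \<phi> q = dil_semigroup l P t \<phi> q"
proof -
  have P': "contraction_semigroup lborel P" and gen: "generator lborel P = sublap_graph"
    using P by (auto simp: heat_semigroup_def)
  show ?thesis
    by (rule contraction_semigroup_unique[OF P' contraction_semigroup_dil[OF P' l]])
      (use sublap_graph_subset_generator_dil[OF P l] test_function_sublap_graph[OF \<phi>] gen t in auto)
qed

subsection \<open>Scaling of the heat kernel\<close>

text \<open>Dilations are automorphisms because the central term of the product is bilinear in the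
  horizontal coordinates, so it scales like z.\<close>

lemma heis_dil_mult: "heis_dil l (heis_mult p q) = heis_mult (heis_dil l p) (heis_dil l q)"
  by (cases p; cases q)
    (simp add: scaleR_add_right sum_distrib_left power2_eq_square algebra_simps)

lemma heis_dil_inv: "heis_dil l (heis_inv p) = heis_inv (heis_dil l p)"
  by (cases p) simp

lemma heis_dil_e: "heis_dil l heis_e = heis_e"
  by (simp add: heis_e_def)

lemma continuous_on_heis_inv_mult:
  "continuous_on UNIV (\<lambda>(p, q). heis_mult (heis_inv p) q :: 'n::finite heis)"
proof -
  have eq: "(\<lambda>(p, q). heis_mult (heis_inv p) q :: 'n heis) =
    (\<lambda>w. (fst (snd w) - fst (fst w), fst (snd (snd w)) - fst (snd (fst w)),
      snd (snd (snd w)) - snd (snd (fst w)) +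
      2 * (\<Sum>i\<in>UNIV. fst (fst w) $ i * fst (snd (snd w)) $ i - fst (snd w) $ i * fst (snd (fst w)) $ i)))"
    by (auto simp: fun_eq_iff)
  show ?thesis unfolding eq by (intro continuous_intros)
qed

lemma AE_lborel_not_open_False:
  fixes S :: "'a::euclidean_space set"
  assumes "open S" "S \<noteq> {}" "AE q in lborel. q \<notin> S"
  shows False
proof -
  have "S \<in> null_sets lborel"
    using assms AE_iff_null_sets[of S lborel] by simp
  then have "negligible S"
    by (simp add: negligible_iff_null_sets null_sets_completionI)
  then show False using open_not_negligible assms by blast
qed

text \<open>The kernel is tested against a bump concentrated where it has a constant sign.\<close>

lemma convolution_kernel_eq_0:
  fixes D :: "'n::finite heis \<Rightarrow> real"
  assumes D: "continuous_on UNIV D"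
    and 0: "\<And>\<phi>. test_function \<phi> \<Longrightarrow> AE q1 in lborel.
      integrable lborel (\<lambda>q2. D (heis_mult (heis_inv q1) q2) * \<phi> q2) \<and>
      (LINT q2|lborel. D (heis_mult (heis_inv q1) q2) * \<phi> q2) = 0"
  shows "D q0 = 0"
proof (rule ccontr)
  assume "D q0 \<noteq> 0"
  \<comment> \<open>The factor \<open>D q0\<close> makes the value at the base point a square, which
    avoids distinguishing the sign of \<open>D q0\<close>.\<close>
  define E where "E w = D q0 * D (heis_mult (heis_inv (fst w)) (snd w))" for w
  have "continuous_on UNIV E"
    unfolding E_def using continuous_on_compose2[OF D continuous_on_heis_inv_mult]
    by (intro continuous_intros) (simp add: case_prod_beta')
  then have "open (E -` {0<..})" by (intro open_vimage) auto
  moreover have "(heis_e, q0) \<in> E -` {0<..}"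
  proof -
    have "heis_mult (heis_inv heis_e) q0 = q0" by (cases q0) (simp add: heis_e_def)
    then have "E (heis_e, q0) = (D q0)\<^sup>2" by (simp only: E_def fst_conv snd_conv power2_eq_square)
    then show ?thesis using \<open>D q0 \<noteq> 0\<close> by simp
  qed
  \<comment> \<open>A product neighbourhood is needed: the hypothesis holds for almost every
    \<open>q1\<close> only, so it has to fail for all \<open>q1\<close> in a nonempty open set, with
    one bump that serves all of them.\<close>
  ultimately obtain A B where "open A" "open B" "(heis_e, q0) \<in> A \<times> B" "A \<times> B \<subseteq> E -` {0<..}"
    by (rule open_prod_elim)
  then have AB: "open A" "open B" "heis_e \<in> A" "q0 \<in> B" "A \<times> B \<subseteq> E -` {0<..}" by simp_all
  obtain r where r: "r > 0" "ball q0 r \<subseteq> B" using AB(2,4) open_contains_ball by blast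
  obtain \<phi> where \<phi>: "test_function \<phi>" "\<And>q. 0 \<le> \<phi> q" "\<And>q. \<phi> q \<noteq> 0 \<longleftrightarrow> q \<in> ball q0 r"
    using exists_bump[OF r(1)] by metis
  have pos: "E (q1, q2) > 0" if "q1 \<in> A" "q2 \<in> ball q0 r" for q1 q2
  proof -
    have "(q1, q2) \<in> A \<times> B" using that r by auto
    then have "(q1, q2) \<in> E -` {0<..}" using AB(5) by (rule subsetD[rotated])
    then show ?thesis by simp
  qed
  have "AE q1 in lborel. q1 \<notin> A"
    using 0[OF \<phi>(1)]
  proof eventually_elim
    case (elim q1)
    show ?case
    proof
      assume q1: "q1 \<in> A"
      let ?F = "\<lambda>q2. D q0 * (D (heis_mult (heis_inv q1) q2) * \<phi> q2)"
      have F: "?F q2 = E (q1, q2) * \<phi> q2" for q2 by (simp add: E_def)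
      have nn: "0 \<le> ?F q2" for q2
      proof (cases "q2 \<in> ball q0 r")
        case True
        then show ?thesis unfolding F using pos[OF q1 True] \<phi>(2)[of q2] by simp
      next
        case False
        then have "\<phi> q2 = 0" using \<phi>(3) by blast
        then show ?thesis by simp
      qed
      have "integrable lborel ?F" "(LINT q2|lborel. ?F q2) = 0" using elim by simp_all
      then have "AE q2 in lborel. ?F q2 = 0"
        using integral_nonneg_eq_0_iff_AE[of lborel ?F] nn by blast
      then have "AE q2 in lborel. q2 \<notin> ball q0 r"
      proof eventually_elim
        case (elim q2)
        then show ?case using pos[OF q1, of q2] \<phi>(3)[of q2] unfolding F by auto
      qed
      then show False by (rule AE_lborel_not_open_False[rotated 2]) (use r in auto)
    qed
  qed
  then show False by (rule AE_lborel_not_open_False[rotated 2]) (use AB in auto)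
qed

lemma heat_kernel_dil:
  fixes h :: "real \<Rightarrow> 'n::finite heis \<Rightarrow> real"
  assumes h: "heat_kernel h" and l: "l > 0" and t: "t > 0"
  shows "h t q = l ^ (2 * CARD('n) + 2) * h (l\<^sup>2 * t) (heis_dil l q)"
proof -
  define J where "J = l ^ (2 * CARD('n) + 2)"
  obtain P where cont: "continuous_on ({0<..} \<times> UNIV) (\<lambda>(t, q). h t q)" and P: "heat_semigroup P"
    and ker: "\<And>t f. t > 0 \<Longrightarrow> f \<in> L2 lborel \<Longrightarrow> AE q1 in lborel.
           integrable lborel (\<lambda>q2. h t (heis_mult (heis_inv q1) q2) * f q2) \<and>
           P t f q1 = (LINT q2|lborel. h t (heis_mult (heis_inv q1) q2) * f q2)"
    using h unfolding heat_kernel_def by blast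
  have hc: "continuous_on UNIV (h s)" if "s > 0" for s
    using continuous_on_compose2[OF cont, of UNIV "\<lambda>q. (s, q)"] that
    by (simp add: continuous_intros image_subset_iff)
  have t': "l\<^sup>2 * t > 0" and ln: "l \<noteq> 0" and l': "1 / l > 0" using l t by auto
  define D where "D q = h t q - J * h (l\<^sup>2 * t) (heis_dil l q)" for q
  have "continuous_on UNIV D"
    unfolding D_def
    by (intro continuous_intros hc t continuous_on_compose2[OF hc[OF t']]
        linear_continuous_on bounded_linear_heis_dil) auto
  moreover have "AE q1 in lborel.
      integrable lborel (\<lambda>q2. D (heis_mult (heis_inv q1) q2) * \<phi> q2) \<and>
      (LINT q2|lborel. D (heis_mult (heis_inv q1) q2) * \<phi> q2) = 0"
    if \<phi>: "test_function \<phi>" for \<phi>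
  proof -
    let ?\<phi> = "\<lambda>q. \<phi> (heis_dil (1 / l) q)"
    have \<phi>2: "\<phi> \<in> L2 lborel" "?\<phi> \<in> L2 lborel" using sublap_L2[OF \<phi>] L2_heis_dil[OF l'] by auto
    have "AE q1 in lborel. P t \<phi> q1 = P (l\<^sup>2 * t) ?\<phi> (heis_dil l q1)"
      using heat_semigroup_dil[OF P l \<phi>, of t] t by (simp add: dil_semigroup_def)
    with ker[OF t \<phi>2(1)] AE_heis_dil[OF l ker[OF t' \<phi>2(2)]] show ?thesis
    proof eventually_elim
      case (elim q1)
      \<comment> \<open>The kernel integral at time \<open>l\<^sup>2 * t\<close> and base point
        \<open>heis_dil l q1\<close>. Substituting \<open>heis_dil l q2\<close> yields the factor
        \<open>J\<close>, undoes the dilation in the test function, and makes the kernel argument a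
        dilation of the original one since dilations are automorphisms.\<close>
      let ?F = "\<lambda>q2. h (l\<^sup>2 * t) (heis_mult (heis_inv (heis_dil l q1)) q2) * ?\<phi> q2"
      have F: "?F (heis_dil l q2) = h (l\<^sup>2 * t) (heis_dil l (heis_mult (heis_inv q1) q2)) * \<phi> q2" for q2
        by (simp only: heis_dil_inverse(2)[OF ln] heis_dil_mult heis_dil_inv)
      have i: "integrable lborel ?F" and i0: "integrable lborel (\<lambda>q2. h t (heis_mult (heis_inv q1) q2) * \<phi> q2)"
        using elim by auto
      then have m: "?F \<in> borel_measurable borel" by (auto dest: borel_measurable_integrable)
      have i1: "integrable lborel (\<lambda>q2. h (l\<^sup>2 * t) (heis_dil l (heis_mult (heis_inv q1) q2)) * \<phi> q2)"
        using integrable_heis_dil[OF l m] i unfolding F by simp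
      have "(LINT q2|lborel. h t (heis_mult (heis_inv q1) q2) * \<phi> q2) = (LINT q2|lborel. ?F q2)"
        using elim by simp
      also have "\<dots> = J * (LINT q2|lborel. h (l\<^sup>2 * t) (heis_dil l (heis_mult (heis_inv q1) q2)) * \<phi> q2)"
        using integral_heis_dil[OF l m] unfolding F J_def .
      finally have *: "(LINT q2|lborel. h t (heis_mult (heis_inv q1) q2) * \<phi> q2) = \<dots>" .
      have D: "D (heis_mult (heis_inv q1) q2) * \<phi> q2 = h t (heis_mult (heis_inv q1) q2) * \<phi> q2
          - J * (h (l\<^sup>2 * t) (heis_dil l (heis_mult (heis_inv q1) q2)) * \<phi> q2)" for q2
        by (simp add: D_def algebra_simps)
      have iJ: "integrable lborel (\<lambda>q2. J * (h (l\<^sup>2 * t) (heis_dil l (heis_mult (heis_inv q1) q2)) * \<phi> q2))"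
        using i1 by (rule integrable_mult_right)
      show ?case
        unfolding D Bochner_Integration.integral_diff[OF i0 iJ] * integral_mult_right_zero
        using Bochner_Integration.integrable_diff[OF i0 iJ] by simp
    qed
  qed
  ultimately have "D q = 0" by (rule convolution_kernel_eq_0)
  then show ?thesis by (simp add: D_def J_def)
qed

text \<open>The exponent is 2 + 2(\<alpha> - 1) - (2n + 2): the change of variable in time, the
  power of t, and the scaling of the heat kernel.\<close>

lemma G_kernel_dil:
  fixes h :: "real \<Rightarrow> 'n::finite heis \<Rightarrow> real"
  assumes h: "heat_kernel h" and l: "l > 0"
  shows "G_kernel h \<alpha> (heis_dil l p) (heis_dil l q) = l powr (2 * \<alpha> - (2 * real CARD('n) + 2)) * G_kernel h \<alpha> p q"
proof -
  define w where "w = heis_mult (heis_inv p) q"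
  define J where "J = l ^ (2 * CARD('n) + 2)"
  have J: "J > 0" using l by (simp add: J_def)
  have JP: "J = l powr (2 * real CARD('n) + 2)"
    using powr_realpow[OF l, of "2 * CARD('n) + 2"] by (simp add: J_def add.commute)
  have l2: "l\<^sup>2 = l powr 2" using powr_realpow[OF l, of 2] by simp
  have w: "heis_mult (heis_inv (heis_dil l p)) (heis_dil l q) = heis_dil l w"
    by (simp only: w_def heis_dil_mult heis_dil_inv)
  \<comment> \<open>The affine substitution also holds for integrands that are not integrable, where
    both integrals are 0. This covers the diagonal.\<close>
  have "(LINT t:{0<..}|lborel. t powr (\<alpha> - 1) * h t (heis_dil l w))
    = l\<^sup>2 * (LINT t|lborel. indicator {0<..} (l\<^sup>2 * t) * ((l\<^sup>2 * t) powr (\<alpha> - 1) * h (l\<^sup>2 * t) (heis_dil l w)))"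
    unfolding set_lebesgue_integral_def
    using l by (subst lborel_integral_real_affine[of "l\<^sup>2" _ 0]) auto
  also have "(\<lambda>t. indicator {0<..} (l\<^sup>2 * t) * ((l\<^sup>2 * t) powr (\<alpha> - 1) * h (l\<^sup>2 * t) (heis_dil l w)))
    = (\<lambda>t. ((l\<^sup>2) powr (\<alpha> - 1) / J) * (indicator {0<..} t * (t powr (\<alpha> - 1) * h t w)))"
  proof
    fix t :: real
    show "indicator {0<..} (l\<^sup>2 * t) * ((l\<^sup>2 * t) powr (\<alpha> - 1) * h (l\<^sup>2 * t) (heis_dil l w))
      = ((l\<^sup>2) powr (\<alpha> - 1) / J) * (indicator {0<..} t * (t powr (\<alpha> - 1) * h t w))"
    proof (cases "t > 0")
      case True
      have "h t w = J * h (l\<^sup>2 * t) (heis_dil l w)" unfolding J_def by (rule heat_kernel_dil[OF h l True])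
      then show ?thesis using True l J by (simp add: powr_mult)
    next
      case False
      then have "\<not> l\<^sup>2 * t > 0" using l by (simp add: zero_less_mult_iff)
      with False show ?thesis by simp
    qed
  qed
  also have "l\<^sup>2 * (LINT t|lborel. ((l\<^sup>2) powr (\<alpha> - 1) / J) * (indicator {0<..} t * (t powr (\<alpha> - 1) * h t w)))
    = (l\<^sup>2 * (l\<^sup>2) powr (\<alpha> - 1) / J) * (LINT t:{0<..}|lborel. t powr (\<alpha> - 1) * h t w)"
    by (simp add: set_lebesgue_integral_def)
  also have "l\<^sup>2 * (l\<^sup>2) powr (\<alpha> - 1) / J = l powr (2 * \<alpha> - (2 * real CARD('n) + 2))"
  proof -
    have "(l\<^sup>2) powr (\<alpha> - 1) = l powr (2 * (\<alpha> - 1))" unfolding l2 by (simp add: powr_powr)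
    then have "l\<^sup>2 * (l\<^sup>2) powr (\<alpha> - 1) / J = l powr 2 * l powr (2 * (\<alpha> - 1)) / l powr (2 * real CARD('n) + 2)"
      by (simp only: l2 JP)
    also have "\<dots> = l powr (2 + 2 * (\<alpha> - 1) - (2 * real CARD('n) + 2))"
      by (simp only: powr_add powr_diff)
    finally show ?thesis by (simp add: algebra_simps)
  qed
  finally show ?thesis unfolding G_kernel_def w w_def[symmetric] by simp
qed

subsection \<open>The integrands\<close>

definition W_integrand ::
    "(real \<Rightarrow> 'n::finite heis \<Rightarrow> real) \<Rightarrow> real \<Rightarrow> real \<Rightarrow> 'n heis \<Rightarrow> real \<times> 'n heis \<Rightarrow> real" where
  "W_integrand h \<alpha> t x = (\<lambda>(r, q). indicator {0..t} r * (G_kernel h \<alpha> x q - G_kernel h \<alpha> heis_e q))"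

lemma W_integrand_dil:
  fixes h :: "real \<Rightarrow> 'n::finite heis \<Rightarrow> real"
  assumes "heat_kernel h" "l > 0"
  shows "W_integrand h \<alpha> t (heis_dil l x) (r, heis_dil l q)
    = l powr (2 * \<alpha> - (2 * real CARD('n) + 2)) * W_integrand h \<alpha> t x (r, q)"
  using G_kernel_dil[OF assms, of \<alpha> x q] G_kernel_dil[OF assms, of \<alpha> heis_e q]
  by (simp add: W_integrand_def heis_dil_e algebra_simps)

section \<open>Dilations on the product of time and space\<close>

definition time_space_dil :: "real \<Rightarrow> real \<times> 'n::finite heis \<Rightarrow> real \<times> 'n heis" where
  "time_space_dil l = (\<lambda>(r, q). (r, heis_dil l q))"

lemma time_space_dil_inverse: "l \<noteq> 0 \<Longrightarrow> time_space_dil l (time_space_dil (1 / l) p) = p"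
  by (simp only: time_space_dil_def case_prod_unfold fst_conv snd_conv heis_dil_inverse(1) prod.collapse not_False_eq_True)

lemma time_space_dil_measurable [measurable]:
  "time_space_dil l \<in> measurable time_space (time_space :: (real \<times> 'n::finite heis) measure)"
  unfolding time_space_dil_def by measurable

lemma time_space_eq_dil:
  assumes "l > 0"
  shows "(time_space :: (real \<times> 'n::finite heis) measure) =
    density (distr time_space time_space (time_space_dil l)) (\<lambda>_. ennreal (l ^ (2 * CARD('n) + 2)))"
proof -
  define J where "J = l ^ (2 * CARD('n) + 2)"
  have J: "J > 0" using assms by (simp add: J_def)
  let ?T = "restrict_space lborel {0..} :: real measure" and ?H = "lborel :: 'n heis measure"
  have H: "?H = density (distr ?H ?H (heis_dil l)) (\<lambda>_. ennreal J)"
    unfolding J_def using lborel_heis_dil[OF assms] by (simp cong: distr_cong)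
  \<comment> \<open>Products of densities and of image measures require sigma-finite factors. The
    image of Lebesgue measure qualifies because it is Lebesgue measure with constant density
    \<open>1 / J\<close>.\<close>
  have sf: "sigma_finite_measure (distr ?H ?H (heis_dil l))"
  proof -
    have "distr ?H ?H (heis_dil l) = density ?H (\<lambda>_. ennreal (1 / J))"
      by (subst (2) H) (use J in \<open>simp add: density_density_eq ennreal_mult[symmetric] density_1\<close>)
    then show ?thesis by (simp add: sigma_finite_measure.sigma_finite_iff_density_finite[OF sigma_finite_lborel])
  qed
  have d: "distr ?T ?T (\<lambda>r. r) = ?T" by (rule distr_id)
  have sfH: "sigma_finite_measure (density (distr ?H ?H (heis_dil l)) (\<lambda>_. ennreal J))"
    using H sigma_finite_lborel by metis
  have "?T \<Otimes>\<^sub>M ?H = density ?T (\<lambda>_. 1) \<Otimes>\<^sub>M density (distr ?H ?H (heis_dil l)) (\<lambda>_. ennreal J)"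
    using H by (simp add: density_1)
  also have "\<dots> = density (?T \<Otimes>\<^sub>M distr ?H ?H (heis_dil l)) (\<lambda>(x, y). 1 * ennreal J)"
    by (rule pair_measure_density) (use sf sfH in auto)
  also have "?T \<Otimes>\<^sub>M distr ?H ?H (heis_dil l) = distr ?T ?T (\<lambda>r. r) \<Otimes>\<^sub>M distr ?H ?H (heis_dil l)"
    by (simp only: d)
  also have "\<dots> = distr (?T \<Otimes>\<^sub>M ?H) (?T \<Otimes>\<^sub>M ?H) (\<lambda>(x, y). (x, heis_dil l y))"
    by (rule pair_measure_distr) (use sf in auto)
  finally show ?thesis by (simp add: J_def time_space_dil_def case_prod_beta')
qed

lemma integral_time_space_dil:
  fixes f :: "real \<times> 'n::finite heis \<Rightarrow> real"
  assumes [measurable]: "f \<in> borel_measurable time_space" and l: "l > 0"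
  shows "integrable time_space f \<longleftrightarrow> integrable time_space (\<lambda>p. f (time_space_dil l p))"
    and "(LINT p|time_space. f p) = l ^ (2 * CARD('n) + 2) * (LINT p|time_space. f (time_space_dil l p))"
proof -
  define J where "J = l ^ (2 * CARD('n) + 2)"
  have J: "J > 0" using l by (simp add: J_def)
  note eq = time_space_eq_dil[OF l, where 'n='n, folded J_def]
  have "integrable time_space f \<longleftrightarrow>
      integrable (density (distr time_space time_space (time_space_dil l)) (\<lambda>_. ennreal J)) f"
    using eq by simp
  also have "\<dots> \<longleftrightarrow> integrable time_space (\<lambda>p. f (time_space_dil l p))"
    using J by (simp add: integrable_density integrable_distr_eq)
  finally show "integrable time_space f \<longleftrightarrow> integrable time_space (\<lambda>p. f (time_space_dil l p))" .
  have "(LINT p|time_space. f p) =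
      (LINT p|density (distr time_space time_space (time_space_dil l)) (\<lambda>_. ennreal J). f p)"
    using eq by simp
  also have "\<dots> = J * (LINT p|time_space. f (time_space_dil l p))"
    using J by (simp add: integral_density integral_distr)
  finally show "(LINT p|time_space. f p) = l ^ (2 * CARD('n) + 2) * (LINT p|time_space. f (time_space_dil l p))"
    by (simp only: J_def)
qed

lemma L2_time_space_dil:
  assumes "f \<in> L2 time_space" "l > 0"
  shows "(\<lambda>p. f (time_space_dil l p)) \<in> L2 time_space"
  using assms integral_time_space_dil(1)[of "\<lambda>p. (f p)\<^sup>2" l] by (auto simp: L2_def)

text \<open>Ensures that \<open>wiener_integral\<close> takes its default value at the dilated point
  exactly when it does so at the original one. The converse direction uses the inverse
  dilation.\<close>

lemma W_integrand_dil_L2_iff: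
  fixes h :: "real \<Rightarrow> 'n::finite heis \<Rightarrow> real"
  assumes h: "heat_kernel h" and l: "l > 0"
  shows "W_integrand h \<alpha> t (heis_dil l x) \<in> L2 time_space \<longleftrightarrow> W_integrand h \<alpha> t x \<in> L2 time_space"
proof -
  define c where "c = l powr (2 * \<alpha> - (2 * real CARD('n) + 2))"
  have c: "c \<noteq> 0" using l by (simp add: c_def)
  have ln: "l \<noteq> 0" and l': "1 / l > 0" using l by auto
  have *: "W_integrand h \<alpha> t (heis_dil l x) (time_space_dil l p) = c * W_integrand h \<alpha> t x p" for p
    using W_integrand_dil[OF h l] by (cases p) (simp only: time_space_dil_def c_def prod.case)
  show ?thesis
  proof
    assume "W_integrand h \<alpha> t (heis_dil l x) \<in> L2 time_space"
    from L2_cmult[OF L2_time_space_dil[OF this l], of "1 / c"]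
    show "W_integrand h \<alpha> t x \<in> L2 time_space" using c by (simp add: *)
  next
    assume "W_integrand h \<alpha> t x \<in> L2 time_space"
    from L2_time_space_dil[OF L2_cmult[OF this, of c] l']
    have "(\<lambda>p. W_integrand h \<alpha> t (heis_dil l x) (time_space_dil l (time_space_dil (1 / l) p))) \<in> L2 time_space"
      by (simp only: *)
    then show "W_integrand h \<alpha> t (heis_dil l x) \<in> L2 time_space"
      by (simp only: time_space_dil_inverse[OF ln])
  qed
qed

text \<open>The Jacobian contributes the exponent 2n + 2 once, and each of the two integrands
  contributes 2\<alpha> - (2n + 2). The sum is twice 2\<alpha> - (n + 1).\<close>

lemma W_integrand_dil_covariance:
  fixes h :: "real \<Rightarrow> 'n::finite heis \<Rightarrow> real"
  assumes h: "heat_kernel h" and l: "l > 0"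
    and L2: "W_integrand h \<alpha> t x \<in> L2 time_space" "W_integrand h \<alpha> s y \<in> L2 time_space"
  shows "(LINT p|time_space. W_integrand h \<alpha> t (heis_dil l x) p * W_integrand h \<alpha> s (heis_dil l y) p)
    = (l powr (2 * \<alpha> - (real CARD('n) + 1)))\<^sup>2 * (LINT p|time_space. W_integrand h \<alpha> t x p * W_integrand h \<alpha> s y p)"
proof -
  define c where "c = l powr (2 * \<alpha> - (2 * real CARD('n) + 2))"
  have *: "W_integrand h \<alpha> t (heis_dil l x) (time_space_dil l p) = c * W_integrand h \<alpha> t x p" for t x p
    using W_integrand_dil[OF h l] by (cases p) (simp only: time_space_dil_def c_def prod.case)
  have "(\<lambda>p. W_integrand h \<alpha> t (heis_dil l x) p * W_integrand h \<alpha> s (heis_dil l y) p) \<in> borel_measurable time_space"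
    using L2 W_integrand_dil_L2_iff[OF h l] by (intro borel_measurable_times L2D(1)) auto
  from integral_time_space_dil(2)[OF this l]
  have "(LINT p|time_space. W_integrand h \<alpha> t (heis_dil l x) p * W_integrand h \<alpha> s (heis_dil l y) p)
    = l ^ (2 * CARD('n) + 2) * (LINT p|time_space. c\<^sup>2 * (W_integrand h \<alpha> t x p * W_integrand h \<alpha> s y p))"
    by (simp only: * power2_eq_square ac_simps)
  also have "\<dots> = l ^ (2 * CARD('n) + 2) * c\<^sup>2 * (LINT p|time_space. W_integrand h \<alpha> t x p * W_integrand h \<alpha> s y p)"
    by (simp only: integral_mult_right_zero mult.assoc)
  also have "l ^ (2 * CARD('n) + 2) * c\<^sup>2 = (l powr (2 * \<alpha> - (real CARD('n) + 1)))\<^sup>2"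
  proof -
    have "l ^ (2 * CARD('n) + 2) = l powr (2 * real CARD('n) + 2)"
      using powr_realpow[OF l, of "2 * CARD('n) + 2"] by (simp add: add.commute)
    then have "l ^ (2 * CARD('n) + 2) * c\<^sup>2 = l powr (2 * real CARD('n) + 2
        + ((2 * \<alpha> - (2 * real CARD('n) + 2)) + (2 * \<alpha> - (2 * real CARD('n) + 2))))"
      by (simp only: c_def power2_eq_square powr_add)
    also have "\<dots> = l powr ((2 * \<alpha> - (real CARD('n) + 1)) + (2 * \<alpha> - (real CARD('n) + 1)))"
      by (rule arg_cong[where f="(powr) l"]) simp
    finally show ?thesis by (simp only: powr_add power2_eq_square)
  qed
  finally show ?thesis .
qed

subsection \<open>Laws determined by characteristic functions\<close>

lemma cis_eq_iexp: "cis x = iexp x"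
  by (simp add: cis_conv_exp)

lemma cis_measurable [measurable]: "f \<in> borel_measurable M \<Longrightarrow> (\<lambda>x. cis (f x)) \<in> borel_measurable M"
  unfolding cis_eq_iexp by measurable

text \<open>A nonnegative bounded weight turns \<open>M\<close> into a finite measure. Once
  normalised, its image under the variable is a probability law on the line, to which
  \<open>Levy_uniqueness\<close> applies.\<close>

lemma (in prob_space) weighted_Levy_uniqueness:
  fixes X Y g k :: "'a \<Rightarrow> real"
  assumes [measurable]: "X \<in> borel_measurable M" "Y \<in> borel_measurable M"
      "g \<in> borel_measurable M" "k \<in> borel_measurable M"
    and g: "\<And>\<omega>. 0 \<le> g \<omega>" "\<And>\<omega>. g \<omega> \<le> B" and k: "\<And>\<omega>. 0 \<le> k \<omega>" "\<And>\<omega>. k \<omega> \<le> B"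
    and eq: "\<And>v. (CLINT \<omega>|M. g \<omega> * cis (v * X \<omega>)) = (CLINT \<omega>|M. k \<omega> * cis (v * Y \<omega>))"
    and A [measurable]: "A \<in> sets borel"
  shows "(LINT \<omega>|M. g \<omega> * indicator A (X \<omega>)) = (LINT \<omega>|M. k \<omega> * indicator A (Y \<omega>))"
proof -
  have gi: "integrable M g" and ki: "integrable M k"
    using g k by (auto intro!: integrable_const_bound[of _ B])
  define m where "m = (LINT \<omega>|M. g \<omega>)"
  \<comment> \<open>At \<open>v = 0\<close> the hypothesis says that both weights have the same
    mass, so one constant normalises both. Mass 0 cannot be normalised and is treated
    separately.\<close>
  have mk: "m = (LINT \<omega>|M. k \<omega>)"
    using eq[of 0] by (simp add: m_def)
  have "0 \<le> m" using g by (simp add: m_def)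
  show ?thesis
  proof (cases "m = 0")
    case True
    then have "AE \<omega> in M. g \<omega> = 0" "AE \<omega> in M. k \<omega> = 0"
      using integral_nonneg_eq_0_iff_AE[OF gi] integral_nonneg_eq_0_iff_AE[OF ki] g k mk m_def by auto
    then have "(LINT \<omega>|M. g \<omega> * indicator A (X \<omega>)) = (LINT \<omega>|M. 0)"
      "(LINT \<omega>|M. k \<omega> * indicator A (Y \<omega>)) = (LINT \<omega>|M. 0)"
      by (intro integral_cong_AE; auto)+
    then show ?thesis by simp
  next
    case False
    with \<open>0 \<le> m\<close> have m: "m > 0" by simp
    define N where "N Z f = distr (density M (\<lambda>\<omega>. ennreal (f \<omega> / m))) borel Z" for Z f :: "'a \<Rightarrow> real"
    have N: "real_distribution (N Z f)" "char (N Z f) = (\<lambda>v. (CLINT \<omega>|M. f \<omega> * cis (v * Z \<omega>)) / m)"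
        "measure (N Z f) A = (LINT \<omega>|M. f \<omega> * indicator A (Z \<omega>)) / m"
      if [measurable]: "Z \<in> borel_measurable M" "f \<in> borel_measurable M"
        and f: "\<And>\<omega>. 0 \<le> f \<omega>" "integrable M f" "(LINT \<omega>|M. f \<omega>) = m" for Z f
    proof -
      have "emeasure (density M (\<lambda>\<omega>. ennreal (f \<omega> / m))) (space M) = ennreal (LINT \<omega>|M. f \<omega> / m)"
        using f m by (simp add: emeasure_density nn_integral_eq_integral cong: nn_integral_cong)
      then have p: "prob_space (density M (\<lambda>\<omega>. ennreal (f \<omega> / m)))"
        using f m by (intro prob_spaceI) simp
      then show rd: "real_distribution (N Z f)"
        unfolding N_def real_distribution_def real_distribution_axioms_def
        by (auto intro!: prob_space.prob_space_distr)
      show "char (N Z f) = (\<lambda>v. (CLINT \<omega>|M. f \<omega> * cis (v * Z \<omega>)) / m)"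
        using f m by (simp add: fun_eq_iff char_def N_def cis_eq_iexp integral_distr integral_density
            scaleR_conv_of_real)
      have "measure (N Z f) A = (LINT x|N Z f. indicator A x)"
        by (simp add: N_def)
      also have "\<dots> = (LINT \<omega>|density M (\<lambda>\<omega>. ennreal (f \<omega> / m)). indicator A (Z \<omega>))"
        unfolding N_def by (rule integral_distr) measurable
      also have "\<dots> = (LINT \<omega>|M. (f \<omega> / m) *\<^sub>R indicator A (Z \<omega>))"
        using f m by (intro integral_density) auto
      also have "\<dots> = (LINT \<omega>|M. f \<omega> * indicator A (Z \<omega>)) / m"
        by simp
      finally show "measure (N Z f) A = (LINT \<omega>|M. f \<omega> * indicator A (Z \<omega>)) / m" .
    qed
    have "N X g = N Y k"
    proof (rule Levy_uniqueness)
      show "char (N X g) = char (N Y k)"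
        using N(2)[of X g] N(2)[of Y k] g k gi ki m_def mk eq by simp
    qed (use N(1)[of X g] N(1)[of Y k] g k gi ki m_def mk in simp_all)
    then show ?thesis
      using N(3)[of X g] N(3)[of Y k] g k gi ki m_def mk m by simp
  qed
qed

text \<open>Makes the nonnegative weight accessible to the induction hypothesis, which knows
  integrals of pure exponentials only.\<close>

lemma cis_mult_one_plus_cos: "complex_of_real (1 + cos b) * cis a = cis a + (cis (a + b) + cis (a - b)) / 2"
  by (simp add: complex_eq_iff cos_add cos_diff sin_add sin_diff algebra_simps)

text \<open>Coordinates are converted one at a time from exponentials to indicators. The weights
  \<open>1 + cos\<close> make the remaining exponentials nonnegative, so that the one-dimensional theorem applies.\<close>

lemma (in prob_space) indicator_char_eq:
  fixes X Y :: "'i \<Rightarrow> 'a \<Rightarrow> real"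
  assumes J: "finite J"
    and X [measurable]: "\<And>j. j \<in> J \<Longrightarrow> X j \<in> borel_measurable M"
    and Y [measurable]: "\<And>j. j \<in> J \<Longrightarrow> Y j \<in> borel_measurable M"
    and A [measurable]: "\<And>j. j \<in> J \<Longrightarrow> A j \<in> sets borel"
    and eq: "\<And>u. (CLINT \<omega>|M. cis (\<Sum>j\<in>J. u j * X j \<omega>)) = (CLINT \<omega>|M. cis (\<Sum>j\<in>J. u j * Y j \<omega>))"
    and K: "K \<subseteq> J"
  shows "(CLINT \<omega>|M. (\<Prod>j\<in>K. indicator (A j) (X j \<omega>) :: real) * cis (\<Sum>j\<in>J. u j * X j \<omega>)) =
    (CLINT \<omega>|M. (\<Prod>j\<in>K. indicator (A j) (Y j \<omega>) :: real) * cis (\<Sum>j\<in>J. u j * Y j \<omega>))"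
  using finite_subset[OF K J] K
proof (induction K arbitrary: u rule: finite_induct)
  case empty
  then show ?case using eq by simp
next
  case (insert i K)
  then have i: "i \<in> J" and KJ: "K \<subseteq> J" by auto
  define S where "S u Z \<omega> = (\<Sum>j\<in>J. u j * Z j \<omega>)" for u and Z :: "'i \<Rightarrow> 'a \<Rightarrow> real" and \<omega>
  define w where "w Z \<omega> = (\<Prod>j\<in>K. indicator (A j) (Z j \<omega>) :: real)" for Z :: "'i \<Rightarrow> 'a \<Rightarrow> real" and \<omega>
  have [measurable]: "X i \<in> borel_measurable M" "Y i \<in> borel_measurable M" "A i \<in> sets borel"
    using X Y A i by auto
  have Sm [measurable]: "S u X \<in> borel_measurable M" "S u Y \<in> borel_measurable M" for u
    unfolding S_def by measurable
  have wm [measurable]: "w X \<in> borel_measurable M" "w Y \<in> borel_measurable M"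
    unfolding w_def using KJ
    by (intro borel_measurable_prod measurable_compose[OF X borel_measurable_indicator[OF A]]
        measurable_compose[OF Y borel_measurable_indicator[OF A]]; auto)+
  have w01: "0 \<le> w Z \<omega>" "w Z \<omega> \<le> 1" for Z \<omega>
    unfolding w_def by (auto intro!: prod_nonneg prod_le_1)
  have IH: "(CLINT \<omega>|M. w X \<omega> * cis (S u X \<omega>)) = (CLINT \<omega>|M. w Y \<omega> * cis (S u Y \<omega>))" for u
    unfolding w_def S_def by (rule insert.IH[OF KJ])
  have Supd: "S (u(i := u i + v)) Z \<omega> = S u Z \<omega> + v * Z i \<omega>" for u v Z \<omega>
  proof -
    have "S (u(i := u i + v)) Z \<omega> = (\<Sum>j\<in>J. u j * Z j \<omega> + (if j = i then v * Z i \<omega> else 0))"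
      unfolding S_def by (intro sum.cong) (auto simp: algebra_simps)
    then show ?thesis using i J by (simp add: sum.distrib S_def)
  qed
  have S0: "S (\<lambda>j. 0) Z \<omega> = 0" and Sminus: "S (\<lambda>j. - u j) Z \<omega> = - S u Z \<omega>" for u Z \<omega>
    by (simp_all add: S_def sum_negf)
  have intg: "integrable M (\<lambda>\<omega>. w X \<omega> * cis (f \<omega>))" "integrable M (\<lambda>\<omega>. w Y \<omega> * cis (f \<omega>))"
    if "f \<in> borel_measurable M" for f
    using that w01 by (auto intro!: integrable_const_bound[of _ 1] simp: norm_mult)
  \<comment> \<open>The phase \<theta> is free so that 0 gives the real part and -pi/2 the imaginary
    part of the exponential at the end.\<close>
  have key: "(LINT \<omega>|M. w X \<omega> * (1 + cos (S u X \<omega> + \<theta>)) * indicator (A i) (X i \<omega>))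
    = (LINT \<omega>|M. w Y \<omega> * (1 + cos (S u Y \<omega> + \<theta>)) * indicator (A i) (Y i \<omega>))" for u \<theta>
  proof (rule weighted_Levy_uniqueness[where B=2])
    fix v :: real
    \<comment> \<open>The coefficient vectors of the three exponentials in the expansion: the
      frequency \<open>v\<close> at coordinate \<open>i\<close>, added to 0, to \<open>u\<close> and
      to \<open>- u\<close>.\<close>
    define a :: "'i \<Rightarrow> real" where "a = (\<lambda>j. 0)(i := 0 + v)"
    define b where "b = u(i := u i + v)"
    define c where "c = (\<lambda>j. - u j)(i := - u i + v)"
    have Sa: "S a Z \<omega> = v * Z i \<omega>" and Sb: "S b Z \<omega> = S u Z \<omega> + v * Z i \<omega>"
      and Sc: "S c Z \<omega> = v * Z i \<omega> - S u Z \<omega>" for Z \<omega>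
      using Supd[of "\<lambda>j. 0" v Z \<omega>] Supd[of u v Z \<omega>] Supd[of "\<lambda>j. - u j" v Z \<omega>]
      by (simp_all add: a_def b_def c_def S0 Sminus)
    have expand: "complex_of_real (w Z \<omega> * (1 + cos (S u Z \<omega> + \<theta>))) * cis (v * Z i \<omega>) =
      w Z \<omega> * cis (S a Z \<omega>) + ((cis \<theta> / 2) * (w Z \<omega> * cis (S b Z \<omega>)) + (cis (- \<theta>) / 2) * (w Z \<omega> * cis (S c Z \<omega>)))"
      for Z \<omega>
    proof -
      have e: "cis (v * Z i \<omega> + (S u Z \<omega> + \<theta>)) = cis \<theta> * cis (S b Z \<omega>)"
        "cis (v * Z i \<omega> - (S u Z \<omega> + \<theta>)) = cis (- \<theta>) * cis (S c Z \<omega>)"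
        by (simp_all add: cis_mult Sb Sc algebra_simps)
      have "complex_of_real (w Z \<omega> * (1 + cos (S u Z \<omega> + \<theta>))) * cis (v * Z i \<omega>) =
        w Z \<omega> * (complex_of_real (1 + cos (S u Z \<omega> + \<theta>)) * cis (v * Z i \<omega>))"
        by (simp only: of_real_mult mult.assoc)
      then show ?thesis
        unfolding cis_mult_one_plus_cos e Sa by (simp add: field_simps)
    qed
    have *: "(CLINT \<omega>|M. complex_of_real (w Z \<omega> * (1 + cos (S u Z \<omega> + \<theta>))) * cis (v * Z i \<omega>)) =
      (CLINT \<omega>|M. w Z \<omega> * cis (S a Z \<omega>)) + ((cis \<theta> / 2) * (CLINT \<omega>|M. w Z \<omega> * cis (S b Z \<omega>))
        + (cis (- \<theta>) / 2) * (CLINT \<omega>|M. w Z \<omega> * cis (S c Z \<omega>)))"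
      if "Z = X \<or> Z = Y" for Z
    proof -
      have Z: "integrable M (\<lambda>\<omega>. w Z \<omega> * cis (S r Z \<omega>))" for r using that intg Sm by auto
      show ?thesis
        unfolding expand
        by (subst Bochner_Integration.integral_add, (intro Bochner_Integration.integrable_add integrable_mult_right Z)+)+
          (simp only: integral_mult_right_zero)
    qed
    show "(CLINT \<omega>|M. complex_of_real (w X \<omega> * (1 + cos (S u X \<omega> + \<theta>))) * cis (v * X i \<omega>)) =
      (CLINT \<omega>|M. complex_of_real (w Y \<omega> * (1 + cos (S u Y \<omega> + \<theta>))) * cis (v * Y i \<omega>))"
      by (simp only: * IH simp_thms)
  next
    have c: "0 \<le> 1 + cos x" "1 + cos x \<le> 2" for x :: real
      using cos_ge_minus_one[of x] cos_le_one[of x] by linarith+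
    show "0 \<le> w X \<omega> * (1 + cos (S u X \<omega> + \<theta>))" "0 \<le> w Y \<omega> * (1 + cos (S u Y \<omega> + \<theta>))" for \<omega>
      using w01 c by (auto intro!: mult_nonneg_nonneg)
    show "w X \<omega> * (1 + cos (S u X \<omega> + \<theta>)) \<le> 2" "w Y \<omega> * (1 + cos (S u Y \<omega> + \<theta>)) \<le> 2" for \<omega>
      using mult_mono[OF w01(2) c(2) _ c(1)] by auto
  qed measurable
  define I where "I Z \<omega> = (indicator (A i) (Z i \<omega>) :: real)" for Z :: "'i \<Rightarrow> 'a \<Rightarrow> real" and \<omega>
  have [measurable]: "I X \<in> borel_measurable M" "I Y \<in> borel_measurable M"
    unfolding I_def by measurable
  have I01: "0 \<le> I Z \<omega>" "I Z \<omega> \<le> 1" for Z \<omega> by (auto simp: I_def)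
  have wI: "\<bar>w Z \<omega> * I Z \<omega>\<bar> \<le> 1" for Z \<omega>
    using w01[of Z \<omega>] I01[of Z \<omega>] by (simp add: abs_mult mult_le_one)
  have wIi: "integrable M (\<lambda>\<omega>. w Z \<omega> * I Z \<omega>)" "integrable M (\<lambda>\<omega>. w Z \<omega> * I Z \<omega> * cos (S u Z \<omega> + \<theta>))"
      "integrable M (\<lambda>\<omega>. (w Z \<omega> * I Z \<omega>) * cis (S u Z \<omega>))"
    if "Z = X \<or> Z = Y" for Z u \<theta>
  proof -
    have [measurable]: "w Z \<in> borel_measurable M" "I Z \<in> borel_measurable M" "S u Z \<in> borel_measurable M"
      using that by auto
    have "\<bar>w Z \<omega> * I Z \<omega>\<bar> * \<bar>cos x\<bar> \<le> 1" for \<omega> x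
      using mult_le_one[OF wI _ abs_cos_le_one] by simp
    then show "integrable M (\<lambda>\<omega>. w Z \<omega> * I Z \<omega>)" "integrable M (\<lambda>\<omega>. w Z \<omega> * I Z \<omega> * cos (S u Z \<omega> + \<theta>))"
      "integrable M (\<lambda>\<omega>. (w Z \<omega> * I Z \<omega>) * cis (S u Z \<omega>))"
      using wI by (auto intro!: integrable_const_bound[of _ 1] simp: norm_mult abs_mult)
  qed
  have split: "(LINT \<omega>|M. w Z \<omega> * (1 + cos (S u Z \<omega> + \<theta>)) * indicator (A i) (Z i \<omega>)) =
    (LINT \<omega>|M. w Z \<omega> * I Z \<omega>) + (LINT \<omega>|M. w Z \<omega> * I Z \<omega> * cos (S u Z \<omega> + \<theta>))"
    if "Z = X \<or> Z = Y" for Z u \<theta>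
    unfolding Bochner_Integration.integral_add[OF wIi(1,2)[OF that], symmetric]
    by (rule Bochner_Integration.integral_cong) (auto simp: I_def algebra_simps)
  \<comment> \<open>With zero coefficients and phase 0 the weight is the constant 2. This isolates
    the summand without cosine, which is then cancelled from \<open>key\<close>.\<close>
  have "(LINT \<omega>|M. w X \<omega> * I X \<omega>) = (LINT \<omega>|M. w Y \<omega> * I Y \<omega>)"
    using key[of "\<lambda>j. 0" 0] unfolding split[OF disjI1[OF refl]] split[OF disjI2[OF refl]] by (simp add: S0)
  then have C: "(LINT \<omega>|M. w X \<omega> * I X \<omega> * cos (S u X \<omega> + \<theta>)) = (LINT \<omega>|M. w Y \<omega> * I Y \<omega> * cos (S u Y \<omega> + \<theta>))" for \<theta>
    using key[of u \<theta>] unfolding split[OF disjI1[OF refl]] split[OF disjI2[OF refl]] by simp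
  have sin: "cos (x + - (pi / 2)) = sin x" for x :: real by (simp add: cos_diff)
  have "(CLINT \<omega>|M. (w X \<omega> * I X \<omega>) * cis (S u X \<omega>)) = (CLINT \<omega>|M. (w Y \<omega> * I Y \<omega>) * cis (S u Y \<omega>))"
    using C[of 0] C[of "- (pi / 2)"] wIi(3)[of X u] wIi(3)[of Y u]
    unfolding sin by (simp add: complex_eq_iff integral_Re[symmetric] integral_Im[symmetric])
  moreover have "(\<Prod>j\<in>insert i K. indicator (A j) (Z j \<omega>)) = w Z \<omega> * I Z \<omega>" for Z \<omega>
    using insert.hyps by (simp add: w_def I_def)
  ultimately show ?case by (simp only: S_def)
qed

text \<open>Finite-dimensional information suffices for an arbitrary index set because the product
  sigma-algebra is generated by cylinders over finite sets of coordinates.\<close>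

lemma (in prob_space) equal_in_law_char:
  fixes X Y :: "'i \<Rightarrow> 'a \<Rightarrow> real"
  assumes X: "\<And>i. i \<in> I \<Longrightarrow> X i \<in> borel_measurable M"
    and Y: "\<And>i. i \<in> I \<Longrightarrow> Y i \<in> borel_measurable M"
    and eq: "\<And>J u. finite J \<Longrightarrow> J \<subseteq> I \<Longrightarrow>
      (CLINT \<omega>|M. cis (\<Sum>j\<in>J. u j * X j \<omega>)) = (CLINT \<omega>|M. cis (\<Sum>j\<in>J. u j * Y j \<omega>))"
  shows "equal_in_law M I X Y"
proof -
  let ?P = "\<Pi>\<^sub>M i\<in>I. (borel :: real measure)"
  have m: "(\<lambda>\<omega>. \<lambda>i\<in>I. Z i \<omega>) \<in> measurable M ?P"
    if "\<And>i. i \<in> I \<Longrightarrow> Z i \<in> borel_measurable M" for Z :: "'i \<Rightarrow> 'a \<Rightarrow> real"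
    by (rule measurable_restrict) (use that in simp)
  have cyl: "emeasure (distr M ?P (\<lambda>\<omega>. \<lambda>i\<in>I. Z i \<omega>)) (prod_emb I (\<lambda>_. borel) J (Pi\<^sub>E J A))
      = ennreal (LINT \<omega>|M. (\<Prod>j\<in>J. indicator (A j) (Z j \<omega>)))"
    if Z: "\<And>i. i \<in> I \<Longrightarrow> Z i \<in> borel_measurable M" and J: "finite J" "J \<subseteq> I"
      and A: "\<And>i. i \<in> J \<Longrightarrow> A i \<in> sets borel" for Z J A
  proof -
    let ?S = "{\<omega> \<in> space M. \<forall>j\<in>J. Z j \<omega> \<in> A j}"
    have "?S = (\<lambda>\<omega>. \<lambda>i\<in>I. Z i \<omega>) -` prod_emb I (\<lambda>_. borel) J (Pi\<^sub>E J A) \<inter> space M"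
    proof -
      have "restrict (\<lambda>i\<in>I. Z i \<omega>) J = restrict (\<lambda>i. Z i \<omega>) J" for \<omega>
        using J by (auto simp: restrict_def fun_eq_iff)
      then show ?thesis by (auto simp: prod_emb_def PiE_iff)
    qed
    moreover have "prod_emb I (\<lambda>_. borel) J (Pi\<^sub>E J A) \<in> sets ?P"
      using J A by (intro sets_PiM_I) auto
    ultimately have "emeasure (distr M ?P (\<lambda>\<omega>. \<lambda>i\<in>I. Z i \<omega>)) (prod_emb I (\<lambda>_. borel) J (Pi\<^sub>E J A)) = emeasure M ?S"
      "?S \<in> sets M"
      using m[OF Z] by (simp_all add: emeasure_distr measurable_sets)
    moreover have "(\<Prod>j\<in>J. indicator (A j) (Z j \<omega>) :: real) = indicator ?S \<omega>" if \<omega>: "\<omega> \<in> space M" for \<omega>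
    proof (cases "\<omega> \<in> ?S")
      case True
      then show ?thesis by (auto intro!: prod.neutral)
    next
      case False
      then obtain j where "j \<in> J" "Z j \<omega> \<notin> A j" using \<omega> by auto
      then have "(\<Prod>j\<in>J. indicator (A j) (Z j \<omega>) :: real) = 0"
        using J by (intro prod_zero bexI[of _ j]) auto
      with False show ?thesis by simp
    qed
    then have "(LINT \<omega>|M. (\<Prod>j\<in>J. indicator (A j) (Z j \<omega>) :: real)) = (LINT \<omega>|M. indicator ?S \<omega>)"
      by (intro Bochner_Integration.integral_cong refl)
    ultimately show ?thesis by (simp add: emeasure_eq_measure)
  qed
  have "distr M ?P (\<lambda>\<omega>. \<lambda>i\<in>I. X i \<omega>) = distr M ?P (\<lambda>\<omega>. \<lambda>i\<in>I. Y i \<omega>)"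
  proof (rule measure_eqI_PiM_infinite)
    fix A :: "'i \<Rightarrow> real set" and J
    assume J: "finite J" "J \<subseteq> I" and A: "\<And>i. i \<in> J \<Longrightarrow> A i \<in> sets borel"
    show "emeasure (distr M ?P (\<lambda>\<omega>. \<lambda>i\<in>I. X i \<omega>)) (prod_emb I (\<lambda>_. borel) J (Pi\<^sub>E J A))
      = emeasure (distr M ?P (\<lambda>\<omega>. \<lambda>i\<in>I. Y i \<omega>)) (prod_emb I (\<lambda>_. borel) J (Pi\<^sub>E J A))"
    proof -
      have XJ: "X j \<in> borel_measurable M" and YJ: "Y j \<in> borel_measurable M" if "j \<in> J" for j
        using that J X Y by auto
      \<comment> \<open>With every coordinate converted to an indicator and all frequencies 0, the
        exponential is 1 and the probability of a box remains.\<close>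
      have "(LINT \<omega>|M. (\<Prod>j\<in>J. indicator (A j) (X j \<omega>) :: real)) = (LINT \<omega>|M. (\<Prod>j\<in>J. indicator (A j) (Y j \<omega>)))"
        using indicator_char_eq[OF J(1) XJ YJ A eq[OF J] order.refl, where u="\<lambda>_. 0"]
        by (simp del: of_real_prod)
      then show ?thesis by (simp only: cyl[OF X J A] cyl[OF Y J A])
    qed
  next
    show "finite_measure (distr M ?P (\<lambda>\<omega>. \<lambda>i\<in>I. X i \<omega>))"
      using m[OF X] by (rule finite_measure_distr)
  qed simp_all
  then show ?thesis using X Y by (simp add: equal_in_law_def)
qed

subsection \<open>Gaussian families\<close>

lemma (in prob_space) centered_gaussian_L2:
  assumes "centered_gaussian M Z"
  shows "Z \<in> L2 M"
proof -
  have [measurable]: "Z \<in> borel_measurable M" using assms by (simp add: centered_gaussian_def)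
  have "integrable M (\<lambda>\<omega>. (Z \<omega>)\<^sup>2)"
    using assms unfolding centered_gaussian_def
  proof (elim conjE disjE exE)
    assume "AE \<omega> in M. Z \<omega> = 0"
    then show ?thesis by (subst integrable_cong_AE[where g="\<lambda>_. 0"]) auto
  next
    fix \<sigma> :: real assume \<sigma>: "\<sigma> > 0" and d: "distributed M lborel Z (normal_density 0 \<sigma>)"
    have "integrable lborel (\<lambda>x. normal_density 0 \<sigma> x * x\<^sup>2)"
      using integrable_normal_moment[OF \<sigma>, of 0 2] by simp
    then show ?thesis
      using distributed_integrable[OF d, of "\<lambda>x. x\<^sup>2"] by simp
  qed
  then show ?thesis by (simp add: L2_def)
qed

text \<open>The second moment decides which alternative of \<open>centered_gaussian\<close> holds
  and, in the normal case, the deviation. Frequency 1 is enough, as other frequencies enter through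
  the coefficients of linear combinations.\<close>

lemma (in prob_space) centered_gaussian_char_eq:
  assumes Z: "centered_gaussian M Z" and Z': "centered_gaussian M Z'"
    and eq: "(LINT \<omega>|M. (Z \<omega>)\<^sup>2) = (LINT \<omega>|M. (Z' \<omega>)\<^sup>2)"
  shows "(CLINT \<omega>|M. cis (Z \<omega>)) = (CLINT \<omega>|M. cis (Z' \<omega>))"
proof -
  have normal: "\<exists>\<sigma>>0. distributed M lborel Y (normal_density 0 \<sigma>) \<and> (LINT \<omega>|M. (Y \<omega>)\<^sup>2) = \<sigma>\<^sup>2"
    if Y: "centered_gaussian M Y" and nz: "(LINT \<omega>|M. (Y \<omega>)\<^sup>2) \<noteq> 0" for Y
  proof -
    have "\<not> (AE \<omega> in M. Y \<omega> = 0)"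
    proof
      assume "AE \<omega> in M. Y \<omega> = 0"
      then have "(LINT \<omega>|M. (Y \<omega>)\<^sup>2) = (LINT \<omega>|M. 0)"
        using Y by (intro integral_cong_AE) (auto simp: centered_gaussian_def)
      then show False using nz by simp
    qed
    then obtain \<sigma> where \<sigma>: "\<sigma> > 0" and d: "distributed M lborel Y (normal_density 0 \<sigma>)"
      using Y by (auto simp: centered_gaussian_def)
    have "(LINT \<omega>|M. (Y \<omega>)\<^sup>2) = \<sigma>\<^sup>2"
      using normal_distributed_variance[OF \<sigma> d] normal_distributed_expectation[OF \<sigma> d] by simp
    then show ?thesis using \<sigma> d by blast
  qed
  show ?thesis
  proof (cases "(LINT \<omega>|M. (Z \<omega>)\<^sup>2) = 0")
    case True
    have "(CLINT \<omega>|M. cis (Y \<omega>)) = (CLINT \<omega>|M. 1)"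
      if Y: "centered_gaussian M Y" and z: "(LINT \<omega>|M. (Y \<omega>)\<^sup>2) = 0" for Y
    proof (rule integral_cong_AE)
      have "AE \<omega> in M. Y \<omega> = 0"
        using L2_norm_eq_0[OF centered_gaussian_L2[OF Y]] z by (simp add: L2_norm_def)
      then show "AE \<omega> in M. cis (Y \<omega>) = 1" by eventually_elim simp
    qed (use Y in \<open>auto simp: centered_gaussian_def\<close>)
    then show ?thesis using Z Z' True eq by metis
  next
    case False
    then obtain \<sigma> \<sigma>' where s: "\<sigma> > 0" "\<sigma>' > 0" "\<sigma>\<^sup>2 = \<sigma>'\<^sup>2"
      and d: "distributed M lborel Z (normal_density 0 \<sigma>)" "distributed M lborel Z' (normal_density 0 \<sigma>')"
      using normal[OF Z] normal[OF Z'] eq by metis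
    have "\<sigma> = \<sigma>'" using s by (simp add: power2_eq_iff_nonneg)
    then have "distr M lborel Z = distr M lborel Z'"
      using d by (simp add: distributed_distr_eq_density)
    then have "(CLINT x|distr M lborel Z. cis x) = (CLINT x|distr M lborel Z'. cis x)" by simp
    then show ?thesis
      using distributed_measurable[OF d(1)] distributed_measurable[OF d(2)] by (simp add: integral_distr)
  qed
qed

context prob_space
begin

context
  fixes N :: "'b measure" and W :: "('b \<Rightarrow> real) \<Rightarrow> 'a \<Rightarrow> real"
  assumes W: "white_noise M N W"
begin

text \<open>Distinct indices may carry the same integrand, so their coefficients are collected first.\<close>

lemma wiener_integral_centered_gaussian:
  assumes J: "finite J"
  shows "centered_gaussian M (\<lambda>\<omega>. \<Sum>j\<in>J. u j * wiener_integral N W (f j) \<omega>)"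
proof -
  \<comment> \<open>Terms outside \<open>K\<close> have the default value 0, and only elements of
    \<open>L2 N\<close> are indices of the Gaussian family.\<close>
  define K where "K = {j \<in> J. f j \<in> L2 N}"
  have K: "finite K" "K \<subseteq> J" using J by (auto simp: K_def)
  have "(\<Sum>j\<in>J. u j * wiener_integral N W (f j) \<omega>) = (\<Sum>g\<in>f ` K. (\<Sum>j\<in>{j \<in> K. f j = g}. u j) * W g \<omega>)" for \<omega>
  proof -
    have "(\<Sum>j\<in>J. u j * wiener_integral N W (f j) \<omega>) = (\<Sum>j\<in>K. u j * W (f j) \<omega>)"
      by (rule sum.mono_neutral_cong_right[OF J K(2)]) (auto simp: K_def wiener_integral_def)
    also have "\<dots> = (\<Sum>g\<in>f ` K. \<Sum>j\<in>{j \<in> K. f j = g}. u j * W (f j) \<omega>)"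
      by (rule sum.image_gen[OF K(1)])
    also have "\<dots> = (\<Sum>g\<in>f ` K. (\<Sum>j\<in>{j \<in> K. f j = g}. u j) * W g \<omega>)"
      unfolding sum_distrib_right by (intro sum.cong refl) auto
    finally show ?thesis .
  qed
  moreover have "f ` K \<subseteq> L2 N" by (auto simp: K_def)
  ultimately show ?thesis
    using W K(1) unfolding white_noise_def centered_gaussian_family_def by simp
qed

lemma wiener_integral_L2: "wiener_integral N W f \<in> L2 M"
  using centered_gaussian_L2[OF wiener_integral_centered_gaussian[of "{()}" "\<lambda>_. 1" "\<lambda>_. f"]] by simp

lemma wiener_integral_second_moment:
  assumes "finite J"
  shows "(LINT \<omega>|M. (\<Sum>j\<in>J. u j * wiener_integral N W (f j) \<omega>)\<^sup>2) =
    (\<Sum>i\<in>J. \<Sum>j\<in>J. u i * u j * (if f i \<in> L2 N \<and> f j \<in> L2 N then LINT p|N. f i p * f j p else 0))"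
proof -
  have int: "integrable M (\<lambda>\<omega>. u i * u j * (wiener_integral N W (f i) \<omega> * wiener_integral N W (f j) \<omega>))" for i j
    by (intro integrable_mult_right L2_mult_integrable wiener_integral_L2)
  have cov: "(LINT \<omega>|M. wiener_integral N W (f i) \<omega> * wiener_integral N W (f j) \<omega>) =
      (if f i \<in> L2 N \<and> f j \<in> L2 N then LINT p|N. f i p * f j p else 0)" for i j
    using W by (auto simp: wiener_integral_def white_noise_def)
  have "(\<Sum>j\<in>J. u j * wiener_integral N W (f j) \<omega>)\<^sup>2 =
      (\<Sum>i\<in>J. \<Sum>j\<in>J. u i * u j * (wiener_integral N W (f i) \<omega> * wiener_integral N W (f j) \<omega>))" for \<omega>
    by (simp add: power2_eq_square sum_product ac_simps)
  then have "(LINT \<omega>|M. (\<Sum>j\<in>J. u j * wiener_integral N W (f j) \<omega>)\<^sup>2) =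
      (\<Sum>i\<in>J. \<Sum>j\<in>J. LINT \<omega>|M. u i * u j * (wiener_integral N W (f i) \<omega> * wiener_integral N W (f j) \<omega>))"
    using int by (simp add: integrable_sum)
  then show ?thesis by (simp only: integral_mult_right_zero cov)
qed

end

end

lemma W_field_eq: "W_field h W \<alpha> t x = wiener_integral time_space W (W_integrand h \<alpha> t x)"
  by (simp add: W_field_def W_integrand_def)

theorem proposition3p13:
  fixes M :: "'w measure"
    and h :: "real \<Rightarrow> 'n::finite heis \<Rightarrow> real"
    and W :: "(real \<times> 'n heis \<Rightarrow> real) \<Rightarrow> 'w \<Rightarrow> real"
    and \<alpha> l :: real
  assumes "prob_space M"
    and "white_noise M time_space W"
    and "heat_kernel h"
    and "real CARD('n) / 2 + 1 / 2 < \<alpha>" and "\<alpha> < real CARD('n) / 2 + 1"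
    and "l > 0"
  shows "equal_in_law M ({0..} \<times> UNIV)
    (\<lambda>(t, x). W_field h W \<alpha> t (heis_dil l x))
    (\<lambda>(t, x) \<omega>. l powr (2 * \<alpha> - (real CARD('n) + 1)) * W_field h W \<alpha> t x \<omega>)"
proof -
  interpret prob_space M by fact
  note W = assms(2) and h = assms(3) and l = assms(6)
  define c where "c = l powr (2 * \<alpha> - (real CARD('n) + 1))"
  define f where "f i = W_integrand h \<alpha> (fst i) (snd i)" for i :: "real \<times> 'n heis"
  define f' where "f' i = W_integrand h \<alpha> (fst i) (heis_dil l (snd i))" for i :: "real \<times> 'n heis"
  let ?I = "\<lambda>f i. wiener_integral time_space W (f i)"
  have "equal_in_law M ({0..} \<times> UNIV) (?I f') (\<lambda>i \<omega>. c * ?I f i \<omega>)"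
  proof (rule equal_in_law_char)
    show "?I f' i \<in> borel_measurable M" "(\<lambda>\<omega>. c * ?I f i \<omega>) \<in> borel_measurable M" for i
      using L2D(1)[OF wiener_integral_L2[OF W]] by auto
  next
    fix J :: "(real \<times> 'n heis) set" and u :: "real \<times> 'n heis \<Rightarrow> real"
    assume J: "finite J"
    note G = wiener_integral_centered_gaussian[OF W J]
    note V = wiener_integral_second_moment[OF W J]
    \<comment> \<open>The scale factor is absorbed into the coefficients, so the same two lemmas on
      linear combinations of Wiener integrals serve both fields. In the resulting double sums the
      conditionals of the two sides fall into the same branch.\<close>
    have "(LINT \<omega>|M. (\<Sum>j\<in>J. u j * ?I f' j \<omega>)\<^sup>2) = (LINT \<omega>|M. (\<Sum>j\<in>J. (u j * c) * ?I f j \<omega>)\<^sup>2)"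
      unfolding V
    proof (intro sum.cong refl)
      fix i j
      have "f' k \<in> L2 time_space \<longleftrightarrow> f k \<in> L2 time_space" for k
        unfolding f_def f'_def by (rule W_integrand_dil_L2_iff[OF h l])
      moreover have "(LINT p|time_space. f' i p * f' j p) = c\<^sup>2 * (LINT p|time_space. f i p * f j p)"
        if "f i \<in> L2 time_space" "f j \<in> L2 time_space"
        using W_integrand_dil_covariance[OF h l] that unfolding f_def f'_def c_def by blast
      ultimately show "u i * u j * (if f' i \<in> L2 time_space \<and> f' j \<in> L2 time_space then LINT p|time_space. f' i p * f' j p else 0)
        = u i * c * (u j * c) * (if f i \<in> L2 time_space \<and> f j \<in> L2 time_space then LINT p|time_space. f i p * f j p else 0)"
        by (simp add: power2_eq_square)
    qed
    from centered_gaussian_char_eq[OF G G this]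
    show "(CLINT \<omega>|M. cis (\<Sum>j\<in>J. u j * ?I f' j \<omega>)) = (CLINT \<omega>|M. cis (\<Sum>j\<in>J. u j * (c * ?I f j \<omega>)))"
      by (simp only: mult.assoc)
  qed
  then show ?thesis
    by (simp only: f_def f'_def c_def W_field_eq case_prod_unfold)
qed

end
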